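(* Let $p$ be a prime, $k$ a field of characteristic $p$, $d\ge2$ an integer and $G=\mathbf Z_p^d$. Then the initial vanishing topology on the Witt–Burnside ring $\mathbf W_G(k)$ and the topology on $\mathbf W_G(k)$ defined by (the powers of) its maximal ideal do not agree.
   Context: Witt–Burnside rings. For a profinite group $G$, let $\mathcal F(G)$ be the set of isomorphism classes of finite discrete transitive $G$-sets (each is $G/H$, $H$ open). Write $U\le T$ if there is a $G$-map $T\to U$, and let $\varphi_T(U)$ be the number of $G$-maps $T\to U$. The trivial $G$-set $G/G$ is denoted $0$. The $T$-th Witt polynomial is $W_T(\underline X)=\sum_{U\le T}\varphi_T(U)X_U^{\#T/\#U}$. By Dress–Siebeneicher there are unique polynomials $S_T,M_T\in\mathbf Z[\underline X,\underline Y]$ with $W_T(\underline X)+W_T(\underline Y)=W_T(\underline S)$ and $W_T(\underline X)W_T(\underline Y)=W_T(\underline M)$ for all $T$. For a commutative ring $A$, $\mathbf W_G(A)$ is the set $\prod_{T\in\mathcal F(G)}A$ with $\mathbf a+\mathbf b=(S_T(\mathbf a,\mathbf b))_T$ and $\mathbf a\mathbf b=(M_T(\mathbf a,\mathbf b))_T$; it is a commutative ring. For $n\ge1$, $I_n(G,A)=\{\mathbf a\in\mathbf W_G(A): a_T=0\text{ whenever }\#T<n\}$ is an ideal. The initial vanishing topology on $\mathbf W_G(A)$ is the ring topology for which the ideals $I_n(G,A)$, $n\ge1$, form a fundamental system of neighborhoods of $0$. When $G$ is pro-$p$ and $k$ is a field of characteristic $p$, $\mathbf W_G(k)$ is a local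 ring with maximal ideal $\mathfrak m=\{\mathbf a: a_0=0\}$; the topology defined by the maximal ideal is the $\mathfrak m$-adic topology. *)

theory Defs
  imports
    "HOL-Algebra.Group_Action"
    "HOL-Algebra.Ideal_Product"
    "HOL-Algebra.Product_Groups"
    "HOL-Analysis.Analysis"
    "HOL-Library.Poly_Mapping"
    "HOL-Computational_Algebra.Primes"
begin

section \<open>Finite discrete transitive \<open>G\<close>-sets\<close>

text \<open>
  A topological group is given by a group \<open>G\<close> together with a topology \<open>\<tau>\<close> on its carrier.
  A \<open>G\<close>-set is a pair of an underlying set and an action in the sense of
  \<^locale>\<open>group_action\<close>.
\<close>

type_synonym ('g, 'x) gset = "'x set \<times> ('g \<Rightarrow> 'x \<Rightarrow> 'x)"

definition fdt_gset ::
  "('g, 'm) monoid_scheme \<Rightarrow> 'g topology \<Rightarrow> ('g, 'x) gset \<Rightarrow> bool" where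
  "fdt_gset G \<tau> = (\<lambda>(E, \<phi>).
     transitive_action G E \<phi> \<and> finite E \<and> E \<noteq> {} \<and>
     continuous_map (prod_topology \<tau> (discrete_topology E)) (discrete_topology E)
       (\<lambda>(g, x). \<phi> g x))"

definition gset_maps ::
  "('g, 'm) monoid_scheme \<Rightarrow> ('g, 'x) gset \<Rightarrow> ('g, 'y) gset \<Rightarrow> ('x \<Rightarrow> 'y) set" where
  "gset_maps G = (\<lambda>(E, \<phi>) (E', \<phi>').
     {f \<in> E \<rightarrow>\<^sub>E E'. \<forall>g\<in>carrier G. \<forall>x\<in>E. f (\<phi> g x) = \<phi>' g (f x)})"

definition gset_iso ::
  "('g, 'm) monoid_scheme \<Rightarrow> ('g, 'x) gset \<Rightarrow> ('g, 'y) gset \<Rightarrow> bool" where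
  "gset_iso G S T \<longleftrightarrow> (\<exists>f\<in>gset_maps G S T. bij_betw f (fst S) (fst T))"

text \<open>
  Every finite discrete transitive \<open>G\<close>-set is isomorphic to a coset space \<open>G/H\<close> with \<open>H\<close> open,
  whose points are subsets of \<open>G\<close>. So all isomorphism classes are already represented by
  \<open>G\<close>-sets whose points have type \<^typ>\<open>'g set\<close>, and we take isomorphism classes of those.
\<close>

type_synonym 'g gclass = "('g, 'g set) gset set"

definition gset_iso_rel ::
  "('g, 'm) monoid_scheme \<Rightarrow> 'g topology \<Rightarrow> (('g, 'g set) gset \<times> ('g, 'g set) gset) set" where
  "gset_iso_rel G \<tau> = {(S, T). fdt_gset G \<tau> S \<and> fdt_gset G \<tau> T \<and> gset_iso G S T}"

definition frame :: "('g, 'm) monoid_scheme \<Rightarrow> 'g topology \<Rightarrow> 'g gclass set" where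
  "frame G \<tau> = {T. fdt_gset G \<tau> T} // gset_iso_rel G \<tau>"

definition rep :: "'g gclass \<Rightarrow> ('g, 'g set) gset" where
  "rep T = (SOME t. t \<in> T)"

definition csize :: "'g gclass \<Rightarrow> nat" where
  "csize T = card (fst (rep T))"

definition class_le :: "('g, 'm) monoid_scheme \<Rightarrow> 'g gclass \<Rightarrow> 'g gclass \<Rightarrow> bool" where
  "class_le G U T \<longleftrightarrow> gset_maps G (rep T) (rep U) \<noteq> {}"

definition num_maps :: "('g, 'm) monoid_scheme \<Rightarrow> 'g gclass \<Rightarrow> 'g gclass \<Rightarrow> nat" where
  "num_maps G T U = card (gset_maps G (rep T) (rep U))"

text \<open>The class of the one-point \<open>G\<close>-set \<open>G/G\<close>, whose only point is the coset \<^term>\<open>carrier G\<close>.\<close>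

definition trivial_class :: "('g, 'm) monoid_scheme \<Rightarrow> 'g topology \<Rightarrow> 'g gclass" where
  "trivial_class G \<tau> =
     gset_iso_rel G \<tau> `` {({carrier G}, \<lambda>g. \<lambda>x\<in>{carrier G}. x)}"


section \<open>Witt polynomials and Witt--Burnside rings\<close>

text \<open>
  Integer polynomials in variables indexed by \<^typ>\<open>'v\<close>: finitely supported functions from
  monomials (finitely supported exponent functions) to coefficients, with the convolution
  product of \<^theory>\<open>HOL-Library.Poly_Mapping\<close>.
\<close>

type_synonym 'v int_mpoly = "('v \<Rightarrow>\<^sub>0 nat) \<Rightarrow>\<^sub>0 int"

definition mvar :: "'v \<Rightarrow> 'v int_mpoly" where
  "mvar v = Poly_Mapping.single (Poly_Mapping.single v 1) 1"

definition mpoly_eval :: "('v \<Rightarrow> 'a::comm_ring_1) \<Rightarrow> 'v int_mpoly \<Rightarrow> 'a" where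
  "mpoly_eval x P =
     (\<Sum>m\<in>Poly_Mapping.keys P. of_int (Poly_Mapping.lookup P m) *
        (\<Prod>v\<in>Poly_Mapping.keys m. x v ^ Poly_Mapping.lookup m v))"

text \<open>
  The \<open>T\<close>-th Witt polynomial with the variables \<open>X\<^sub>U\<close> replaced by elements \<open>x U\<close> of an arbitrary
  commutative ring, in particular of a polynomial ring.
\<close>

definition witt_poly ::
  "('g, 'm) monoid_scheme \<Rightarrow> 'g topology \<Rightarrow> 'g gclass \<Rightarrow> ('g gclass \<Rightarrow> 'r::comm_ring_1) \<Rightarrow> 'r"
  where
  "witt_poly G \<tau> T x =
     (\<Sum>U\<in>{U \<in> frame G \<tau>. class_le G U T}.
        of_nat (num_maps G T U) * x U ^ (csize T div csize U))"

text \<open>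
  The families \<open>S\<close> and \<open>M\<close> of polynomials in two sets of variables, \<^term>\<open>Inl U\<close> standing for
  \<open>X\<^sub>U\<close> and \<^term>\<open>Inr U\<close> for \<open>Y\<^sub>U\<close>. Extensionality only fixes the irrelevant values outside the
  frame, so that the families are unique as functions.
\<close>

definition witt_sum_polys ::
  "('g, 'm) monoid_scheme \<Rightarrow> 'g topology \<Rightarrow> 'g gclass \<Rightarrow> ('g gclass + 'g gclass) int_mpoly"
  where
  "witt_sum_polys G \<tau> =
     (THE S. S \<in> extensional (frame G \<tau>) \<and>
        (\<forall>T\<in>frame G \<tau>.
           witt_poly G \<tau> T (\<lambda>U. mvar (Inl U)) + witt_poly G \<tau> T (\<lambda>U. mvar (Inr U))
           = witt_poly G \<tau> T S))"

definition witt_prod_polys ::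
  "('g, 'm) monoid_scheme \<Rightarrow> 'g topology \<Rightarrow> 'g gclass \<Rightarrow> ('g gclass + 'g gclass) int_mpoly"
  where
  "witt_prod_polys G \<tau> =
     (THE M. M \<in> extensional (frame G \<tau>) \<and>
        (\<forall>T\<in>frame G \<tau>.
           witt_poly G \<tau> T (\<lambda>U. mvar (Inl U)) * witt_poly G \<tau> T (\<lambda>U. mvar (Inr U))
           = witt_poly G \<tau> T M))"

text \<open>
  Vectors are extensional functions on the frame. The zero and unit vectors are those with
  \<open>W\<^sub>T(0) = 0\<close> and \<open>W\<^sub>T(1) = 1\<close> for all \<open>T\<close>.
\<close>

definition witt_burnside_ring ::
  "('g, 'm) monoid_scheme \<Rightarrow> 'g topology \<Rightarrow> ('g gclass \<Rightarrow> 'a::comm_ring_1) ring" where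
  "witt_burnside_ring G \<tau> =
     \<lparr> carrier = frame G \<tau> \<rightarrow>\<^sub>E UNIV,
       monoid.mult = (\<lambda>a b. \<lambda>T\<in>frame G \<tau>. mpoly_eval (case_sum a b) (witt_prod_polys G \<tau> T)),
       monoid.one = (\<lambda>T\<in>frame G \<tau>. if T = trivial_class G \<tau> then 1 else 0),
       ring.zero = (\<lambda>T\<in>frame G \<tau>. 0),
       ring.add = (\<lambda>a b. \<lambda>T\<in>frame G \<tau>. mpoly_eval (case_sum a b) (witt_sum_polys G \<tau> T)) \<rparr>"


section \<open>The two topologies\<close>

definition linear_topology :: "('a, 'm) ring_scheme \<Rightarrow> (nat \<Rightarrow> 'a set) \<Rightarrow> 'a topology" where
  "linear_topology R J =
     topology (\<lambda>V. V \<subseteq> carrier R \<and> (\<forall>a\<in>V. \<exists>n\<ge>1. a <+\<^bsub>R\<^esub> J n \<subseteq> V))"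

text \<open>The predicate above is a topology as soon as the \<open>J n\<close> decrease.\<close>

lemma openin_linear_topology:
  assumes "antimono J"
  shows "openin (linear_topology R J) V \<longleftrightarrow>
           V \<subseteq> carrier R \<and> (\<forall>a\<in>V. \<exists>n\<ge>1. a <+\<^bsub>R\<^esub> J n \<subseteq> V)"
proof -
  have mono: "a <+\<^bsub>R\<^esub> J n \<subseteq> a <+\<^bsub>R\<^esub> J m" if "m \<le> n" for a m n
    using antimonoD[OF assms that] by (auto simp: a_l_coset_def')
  have "istopology (\<lambda>V. V \<subseteq> carrier R \<and> (\<forall>a\<in>V. \<exists>n\<ge>1. a <+\<^bsub>R\<^esub> J n \<subseteq> V))"
    unfolding istopology_def
  proof (intro conjI allI impI ballI; (elim conjE)?)
    fix V W a
    assume V: "\<forall>a\<in>V. \<exists>n\<ge>1. a <+\<^bsub>R\<^esub> J n \<subseteq> V" and W: "\<forall>a\<in>W. \<exists>n\<ge>1. a <+\<^bsub>R\<^esub> J n \<subseteq> W"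
      and a: "a \<in> V \<inter> W"
    obtain n where n: "n \<ge> 1" "a <+\<^bsub>R\<^esub> J n \<subseteq> V" using V a by blast
    obtain m where m: "m \<ge> 1" "a <+\<^bsub>R\<^esub> J m \<subseteq> W" using W a by blast
    have "a <+\<^bsub>R\<^esub> J (max n m) \<subseteq> V \<inter> W"
      using n m mono[of n "max n m" a] mono[of m "max n m" a] by auto
    then show "\<exists>n\<ge>1. a <+\<^bsub>R\<^esub> J n \<subseteq> V \<inter> W"
      using n(1) by (intro exI[of _ "max n m"]) auto
  next
    fix \<K> a
    assume "\<forall>K\<in>\<K>. K \<subseteq> carrier R \<and> (\<forall>a\<in>K. \<exists>n\<ge>1. a <+\<^bsub>R\<^esub> J n \<subseteq> K)" "a \<in> \<Union>\<K>"
    then show "\<exists>n\<ge>1. a <+\<^bsub>R\<^esub> J n \<subseteq> \<Union>\<K>" by (meson Union_upper UnionE order_trans)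
  qed auto
  then show ?thesis
    unfolding linear_topology_def by (simp add: topology_inverse')
qed

definition vanishing_ideal ::
  "('g, 'm) monoid_scheme \<Rightarrow> 'g topology \<Rightarrow> nat \<Rightarrow> ('g gclass \<Rightarrow> 'a::comm_ring_1) set" where
  "vanishing_ideal G \<tau> n =
     {a \<in> carrier (witt_burnside_ring G \<tau>). \<forall>T\<in>frame G \<tau>. csize T < n \<longrightarrow> a T = 0}"

definition initial_vanishing_topology ::
  "('g, 'm) monoid_scheme \<Rightarrow> 'g topology \<Rightarrow> ('g gclass \<Rightarrow> 'a::comm_ring_1) topology" where
  "initial_vanishing_topology G \<tau> =
     linear_topology (witt_burnside_ring G \<tau>) (vanishing_ideal G \<tau>)"

primrec ideal_power :: "('a, 'm) ring_scheme \<Rightarrow> 'a set \<Rightarrow> nat \<Rightarrow> 'a set" where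
  "ideal_power R I 0 = carrier R"
| "ideal_power R I (Suc n) = ideal_power R I n \<cdot>\<^bsub>R\<^esub> I"

definition adic_topology :: "('a, 'm) ring_scheme \<Rightarrow> 'a set \<Rightarrow> 'a topology" where
  "adic_topology R I = linear_topology R (ideal_power R I)"

definition witt_max_ideal ::
  "('g, 'm) monoid_scheme \<Rightarrow> 'g topology \<Rightarrow> ('g gclass \<Rightarrow> 'a::field) set" where
  "witt_max_ideal G \<tau> =
     {a \<in> carrier (witt_burnside_ring G \<tau>). a (trivial_class G \<tau>) = 0}"

lemma antimono_vanishing_ideal: "antimono (vanishing_ideal G \<tau>)"
  by (rule antimonoI) (auto simp: vanishing_ideal_def)

lemma antimono_power_witt_max_ideal:
  "antimono (ideal_power (witt_burnside_ring G \<tau>) (witt_max_ideal G \<tau>))"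
proof -
  let ?R = "witt_burnside_ring G \<tau>" and ?I = "witt_max_ideal G \<tau>"
  have mono: "A \<cdot>\<^bsub>?R\<^esub> ?I \<subseteq> B \<cdot>\<^bsub>?R\<^esub> ?I" if "A \<subseteq> B" for A B
  proof
    fix x assume "x \<in> A \<cdot>\<^bsub>?R\<^esub> ?I"
    then show "x \<in> B \<cdot>\<^bsub>?R\<^esub> ?I"
      using that by induction (auto intro: ideal_prod.intros)
  qed
  have base: "A \<cdot>\<^bsub>?R\<^esub> ?I \<subseteq> carrier ?R" for A
  proof
    fix x assume "x \<in> A \<cdot>\<^bsub>?R\<^esub> ?I"
    then show "x \<in> carrier ?R"
      by induction (auto simp: witt_burnside_ring_def)
  qed
  have "ideal_power ?R ?I (Suc n) \<subseteq> ideal_power ?R ?I n" for n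
  proof (induction n)
    case 0
    then show ?case by (simp add: base)
  next
    case (Suc n)
    from mono[OF this] show ?case by simp
  qed
  then show ?thesis
    unfolding decseq_Suc_iff by blast
qed


section \<open>The profinite group \<open>\<int>\<^sub>p\<^sup>d\<close>\<close>

text \<open>
  The additive group \<open>\<int>\<^sub>p\<close> is the inverse limit of the groups \<open>\<int>/p\<^sup>n\<close>, as a subgroup of their
  product and with the subspace topology, each \<open>\<int>/p\<^sup>n\<close> being discrete.
\<close>

definition Zp_group :: "nat \<Rightarrow> (nat \<Rightarrow> int) monoid" where
  "Zp_group p =
     (product_group UNIV (\<lambda>n. integer_mod_group (p ^ n)))
       \<lparr>carrier := {x \<in> (\<Pi>\<^sub>E n\<in>UNIV. carrier (integer_mod_group (p ^ n))).
                    \<forall>n. x (Suc n) mod int (p ^ n) = x n}\<rparr>"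

definition Zp_topology :: "nat \<Rightarrow> (nat \<Rightarrow> int) topology" where
  "Zp_topology p =
     subtopology
       (product_topology (\<lambda>n. discrete_topology (carrier (integer_mod_group (p ^ n)))) UNIV)
       (carrier (Zp_group p))"

definition Zp_power_group :: "nat \<Rightarrow> nat \<Rightarrow> (nat \<Rightarrow> nat \<Rightarrow> int) monoid" where
  "Zp_power_group p d = product_group {..<d} (\<lambda>_. Zp_group p)"

definition Zp_power_topology :: "nat \<Rightarrow> nat \<Rightarrow> (nat \<Rightarrow> nat \<Rightarrow> int) topology" where
  "Zp_power_topology p d = product_topology (\<lambda>_. Zp_topology p) {..<d}"

lemma group_Zp_power: "p > 0 \<Longrightarrow> group (Zp_power_group p d)"
proof -
  assume p: "p > 0"
  let ?P = "product_group (UNIV :: nat set) (\<lambda>n. integer_mod_group (p ^ n))"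
  let ?Z = "carrier (Zp_group p)"
  have P: "group ?P" by simp
  have c: "carrier (integer_mod_group (p ^ n)) = {0..<int (p ^ n)}" for n
    using p by (simp add: carrier_integer_mod_group)
  have Z: "x \<in> ?Z \<longleftrightarrow>
      (\<forall>n. 0 \<le> x n \<and> x n < int p ^ n) \<and> (\<forall>n. x (Suc n) mod int p ^ n = x n)" for x
    by (auto simp: Zp_group_def c PiE_def Pi_def)
  have dvd: "int p ^ n dvd int p ^ Suc n" for n by simp
  have "subgroup ?Z ?P"
  proof (rule group.subgroupI[OF P])
    show "?Z \<subseteq> carrier ?P" by (auto simp: Zp_group_def)
    have "(\<lambda>_. 0) \<in> ?Z" using p by (simp add: Z)
    then show "?Z \<noteq> {}" by blast
  next
    fix x assume x: "x \<in> ?Z"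
    then have "x \<in> carrier ?P" by (auto simp: Zp_group_def)
    then have inv: "inv\<^bsub>?P\<^esub> x = (\<lambda>n. (- x n) mod int p ^ n)"
      using p by (subst inv_product_group) (auto simp: fun_eq_iff PiE_def Pi_def)
    have "(- x (Suc n)) mod int p ^ Suc n mod int p ^ n = (- x n) mod int p ^ n" for n
    proof -
      have "(- x (Suc n)) mod int p ^ Suc n mod int p ^ n = (- x (Suc n)) mod int p ^ n"
        by (rule mod_mod_cancel[OF dvd])
      also have "\<dots> = (- (x (Suc n) mod int p ^ n)) mod int p ^ n"
        by (simp add: mod_minus_eq)
      finally show ?thesis using x by (simp add: Z)
    qed
    then show "inv\<^bsub>?P\<^esub> x \<in> ?Z" using p unfolding inv Z by simp
  next
    fix x y assume xy: "x \<in> ?Z" "y \<in> ?Z"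
    have mult: "x \<otimes>\<^bsub>?P\<^esub> y = (\<lambda>n. (x n + y n) mod int p ^ n)"
      by (simp add: product_group_def fun_eq_iff)
    have "(x (Suc n) + y (Suc n)) mod int p ^ Suc n mod int p ^ n = (x n + y n) mod int p ^ n" for n
    proof -
      have "(x (Suc n) + y (Suc n)) mod int p ^ Suc n mod int p ^ n
          = (x (Suc n) + y (Suc n)) mod int p ^ n"
        by (rule mod_mod_cancel[OF dvd])
      also have "\<dots> = (x (Suc n) mod int p ^ n + y (Suc n) mod int p ^ n) mod int p ^ n"
        by (simp add: mod_add_eq)
      finally show ?thesis using xy by (simp add: Z)
    qed
    then show "x \<otimes>\<^bsub>?P\<^esub> y \<in> ?Z" using p unfolding mult Z by simp
  qed
  from group.subgroup_imp_group[OF P this]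
  have "group (Zp_group p)" by (simp add: Zp_group_def)
  then show ?thesis by (simp add: Zp_power_group_def)
qed

lemma topspace_Zp_power:
  "topspace (Zp_power_topology p d) = carrier (Zp_power_group p d)"
proof -
  have "topspace (Zp_topology p) = carrier (Zp_group p)"
    by (auto simp: Zp_topology_def Zp_group_def)
  then show ?thesis by (simp add: Zp_power_topology_def Zp_power_group_def)
qed

end

theory Submission
  imports
    Defs
    "HOL-Algebra.Multiplicative_Group"
    "HOL-Algebra.Sylow"
begin

text \<open>
  Call two different transitive \<open>G\<close>-sets \<open>S\<close>, \<open>S'\<close> siblings if they have the same size and the same
  proper quotients. Then \<open>W\<^sub>S\<close> and \<open>W\<^sub>S\<^sub>'\<close> differ only in their top terms \<open>#S X\<^sub>S\<close> and \<open>#S X\<^sub>S\<^sub>'\<close>.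
  Write \<open>L\<close> for their common remaining part. Subtracting the equations that define the multiplication
  polynomials and cancelling \<open>#S\<close> gives

    \<open>M\<^sub>S - M\<^sub>S\<^sub>' = L(X) (Y\<^sub>S - Y\<^sub>S\<^sub>') + L(Y) (X\<^sub>S - X\<^sub>S\<^sub>') + #S (X\<^sub>S Y\<^sub>S - X\<^sub>S\<^sub>' Y\<^sub>S\<^sub>')\<close>,

  and the addition polynomials at \<open>S\<close> and \<open>S'\<close> differ by \<open>(X\<^sub>S - X\<^sub>S\<^sub>') + (Y\<^sub>S - Y\<^sub>S\<^sub>')\<close>. In \<open>L\<close> the
  power of \<open>X\<^sub>U\<close> has the coefficient \<open>#U\<close>, which is divisible by \<open>p\<close> unless \<open>U\<close> is the point. So over a field of characteristic \<open>p\<close> the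
  right-hand side vanishes for two vectors of the maximal ideal \<open>\<mm>\<close>: every vector of \<open>\<mm>\<^sup>2\<close> has equal
  coordinates at \<open>S\<close> and \<open>S'\<close> (\<open>square_max_ideal_siblings_eq\<close>). The vector with the single nonzero
  coordinate \<open>1\<close> at \<open>S\<close> violates this, although it lies in \<open>I\<^sub>n\<close> for all \<open>n \<le> #S\<close>. Hence, as soon as
  there are siblings of arbitrarily large size, \<open>\<mm>\<^sup>2\<close> is not open in the initial vanishing topology
  (\<open>topologies_differ\<close>).

  For \<open>d \<ge> 2\<close> the kernels of the two characters \<open>x\<^sub>0\<close> and \<open>x\<^sub>0 + p\<^sup>n\<^sup>-\<^sup>1 x\<^sub>1\<close> modulo \<open>p\<^sup>n\<close> give siblings of
  size \<open>p\<^sup>n\<close> (\<open>Zp_power_siblings\<close>). The quotients are cyclic, so each subgroup properly containing one of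
  the kernels contains the preimage of the subgroup of order \<open>p\<close>; and this preimage, the set where
  \<open>p\<^sup>n\<^sup>-\<^sup>1\<close> divides \<open>x\<^sub>0\<close>, is the same for both characters.
\<close>

text \<open>
  The addition and multiplication polynomials enter by description only, so the argument also rests on
  their existence and uniqueness. Uniqueness holds because \<open>\<int>[X, Y]\<close> is torsion-free. Existence is
  proved for abelian pro-\<open>p\<close> groups by recursion on \<open>T\<close>. Let \<open>w\<close> be the sum or the product of two ghost
  vectors, and let \<open>\<Gamma>\<close> be the finite abelian \<open>p\<close>-group through which \<open>G\<close> acts on \<open>T\<close>. The equation for
  the coordinate at \<open>T\<close> is solvable iff \<open>w\<^sub>T\<close> is congruent modulo \<open>#T = |\<Gamma>|\<close> to the contribution of the
  coordinates already found. With the Frobenius lift \<open>\<psi>\<close> that raises every variable to its \<open>p\<close>-th power,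
  this follows from the congruence

    \<open>\<Sum>\<^sub>g \<psi>\<^sup>v\<^sup>(\<^sup>g\<^sup>)(w\<^sub>\<langle>\<^sub>g\<^sub>\<rangle>) \<equiv> 0\<close> modulo \<open>|\<Gamma>|\<close>, where \<open>g\<close> runs through \<open>\<Gamma>\<close> and has order \<open>p\<^sup>v\<^sup>(\<^sup>g\<^sup>)\<close>,

  which ghost vectors, their sums and their products satisfy (\<open>dvd_cyclic_sum_ghost_mult\<close>): only the
  summand of the unit element involves \<open>T\<close> itself (\<open>ghost_extend\<close>).
\<close>

section \<open>Integer polynomials and the Frobenius lift\<close>

abbreviation eval_monom :: "('v \<Rightarrow> 'a::comm_ring_1) \<Rightarrow> ('v \<Rightarrow>\<^sub>0 nat) \<Rightarrow> 'a" where
  "eval_monom x m \<equiv> (\<Prod>v\<in>Poly_Mapping.keys m. x v ^ Poly_Mapping.lookup m v)"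

lemma eval_monom_superset:
  assumes "finite V" "Poly_Mapping.keys m \<subseteq> V"
  shows "eval_monom x m = (\<Prod>v\<in>V. x v ^ Poly_Mapping.lookup m v)"
  using assms by (intro prod.mono_neutral_left) (auto simp: in_keys_iff)

lemma eval_monom_add: "eval_monom x (m + m') = eval_monom x m * eval_monom x m'"
proof -
  let ?V = "Poly_Mapping.keys m \<union> Poly_Mapping.keys m'"
  have "Poly_Mapping.keys (m + m') \<subseteq> ?V" by (rule keys_add)
  then have "eval_monom x (m + m') = (\<Prod>v\<in>?V. x v ^ Poly_Mapping.lookup (m + m') v)"
    by (intro eval_monom_superset) auto
  also have "\<dots> = (\<Prod>v\<in>?V. x v ^ Poly_Mapping.lookup m v) * (\<Prod>v\<in>?V. x v ^ Poly_Mapping.lookup m' v)"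
    by (simp add: lookup_add power_add prod.distrib)
  also have "\<dots> = eval_monom x m * eval_monom x m'"
    by (intro arg_cong2[of _ _ _ _ times] eval_monom_superset[symmetric]) auto
  finally show ?thesis .
qed

lemma mpoly_eval_superset:
  assumes "finite M" "Poly_Mapping.keys P \<subseteq> M"
  shows "mpoly_eval x P = (\<Sum>m\<in>M. of_int (Poly_Mapping.lookup P m) * eval_monom x m)"
  unfolding mpoly_eval_def using assms by (intro sum.mono_neutral_left) (auto simp: in_keys_iff)

lemma mpoly_eval_add: "mpoly_eval x (P + Q) = mpoly_eval x P + mpoly_eval x Q"
proof -
  let ?M = "Poly_Mapping.keys P \<union> Poly_Mapping.keys Q"
  have "Poly_Mapping.keys (P + Q) \<subseteq> ?M" by (rule keys_add)
  then show ?thesis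
    by (simp add: mpoly_eval_superset[of ?M] lookup_add distrib_right sum.distrib)
qed

lemma mpoly_eval_single: "mpoly_eval x (Poly_Mapping.single m c) = of_int c * eval_monom x m"
  by (cases "c = 0") (simp_all add: mpoly_eval_def)

lemma mpoly_eval_0 [simp]: "mpoly_eval x 0 = 0"
  by (simp add: mpoly_eval_def)

lemma mpoly_eval_sum: "mpoly_eval x (sum P I) = (\<Sum>i\<in>I. mpoly_eval x (P i))"
  by (induction I rule: infinite_finite_induct) (simp_all add: mpoly_eval_add)

lemma int_mpoly_sum_singles:
  fixes P :: "'v int_mpoly"
  shows "P = (\<Sum>m\<in>Poly_Mapping.keys P. Poly_Mapping.single m (Poly_Mapping.lookup P m))"
  by (rule poly_mapping_eqI) (auto simp: lookup_sum lookup_single when_def in_keys_iff)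

lemma mpoly_eval_mult: "mpoly_eval x (P * Q) = mpoly_eval x P * mpoly_eval x Q"
proof -
  let ?s = "Poly_Mapping.single" and ?K = "Poly_Mapping.keys" and ?l = "Poly_Mapping.lookup"
  have "mpoly_eval x (P * Q)
      = mpoly_eval x ((\<Sum>m\<in>?K P. ?s m (?l P m)) * (\<Sum>m\<in>?K Q. ?s m (?l Q m)))"
    using int_mpoly_sum_singles[of P] int_mpoly_sum_singles[of Q] by simp
  also have "\<dots> = (\<Sum>m\<in>?K P. mpoly_eval x (?s m (?l P m))) * (\<Sum>m\<in>?K Q. mpoly_eval x (?s m (?l Q m)))"
    unfolding sum_product
    by (simp add: mpoly_eval_sum mult_single mpoly_eval_single eval_monom_add mult_ac)
  also have "\<dots> = mpoly_eval x P * mpoly_eval x Q"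
    unfolding mpoly_eval_sum[symmetric] using int_mpoly_sum_singles[of P] int_mpoly_sum_singles[of Q] by simp
  finally show ?thesis .
qed

lemma mpoly_eval_1 [simp]: "mpoly_eval x 1 = 1"
  using mpoly_eval_single[of x 0 1] by simp

lemma mpoly_eval_mvar [simp]: "mpoly_eval x (mvar v) = x v"
  by (simp add: mvar_def mpoly_eval_single)

lemma mpoly_eval_of_nat [simp]: "mpoly_eval x (of_nat n) = of_nat n"
  by (induction n) (simp_all add: mpoly_eval_add)

lemma mpoly_eval_power: "mpoly_eval x (P ^ n) = mpoly_eval x P ^ n"
  by (induction n) (simp_all add: mpoly_eval_mult)

lemma mpoly_eval_minus: "mpoly_eval x (- P) = - mpoly_eval x P"
  using mpoly_eval_add[of x P "- P"] by (simp add: eq_neg_iff_add_eq_0 add.commute)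

lemma mpoly_eval_diff: "mpoly_eval x (P - Q) = mpoly_eval x P - mpoly_eval x Q"
  using mpoly_eval_add[of x P "- Q"] by (simp add: mpoly_eval_minus)

lemmas mpoly_eval_hom =
  mpoly_eval_add mpoly_eval_mult mpoly_eval_diff mpoly_eval_minus mpoly_eval_sum mpoly_eval_power

lemma lookup_of_nat_mult:
  fixes P :: "'v int_mpoly"
  shows "Poly_Mapping.lookup (of_nat n * P) m = of_nat n * Poly_Mapping.lookup P m"
  by (induction n) (simp_all add: lookup_add algebra_simps)

lemma of_nat_mult_cancel_mpoly:
  fixes P Q :: "'v int_mpoly"
  assumes "of_nat n * P = of_nat n * Q" "n > 0"
  shows "P = Q"
proof (rule poly_mapping_eqI)
  fix m
  have "int n * Poly_Mapping.lookup P m = int n * Poly_Mapping.lookup Q m"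
    using arg_cong[OF assms(1), of "\<lambda>R. Poly_Mapping.lookup R m"] by (simp add: lookup_of_nat_mult)
  then show "Poly_Mapping.lookup P m = Poly_Mapping.lookup Q m" using assms(2) by simp
qed

text \<open>
  The integer polynomials are generated as a ring by the constants and the variables. Congruences that
  are closed under sums and products need to be checked on these generators only.
\<close>

lemma int_mpoly_induct [case_names const var add mult]:
  fixes P :: "'v int_mpoly"
  assumes const: "\<And>c. A (of_int c)" and var: "\<And>v. A (mvar v)"
    and add: "\<And>P Q. A P \<Longrightarrow> A Q \<Longrightarrow> A (P + Q)" and mult: "\<And>P Q. A P \<Longrightarrow> A Q \<Longrightarrow> A (P * Q)"
  shows "A P"
proof -
  have A0: "A 0" and A1: "A 1" using const[of 0] const[of 1] by simp_all
  have pow: "A (Q ^ n)" if "A Q" for Q n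
    by (induction n) (auto intro: A1 mult that)
  have prd: "A (prod f V)" if "\<And>v. v \<in> V \<Longrightarrow> A (f v)" for f and V :: "'v set"
    using that by (induction V rule: infinite_finite_induct) (auto intro: A1 mult)
  have single_pow: "mvar v ^ n = Poly_Mapping.single (Poly_Mapping.single v n) 1" for v :: 'v and n
    by (induction n) (simp_all add: mvar_def mult_single flip: single_add)
  have prod_single: "(\<Prod>v\<in>V. Poly_Mapping.single (f v) (1::int)) = Poly_Mapping.single (sum f V) 1"
    for V and f :: "'v \<Rightarrow> 'v \<Rightarrow>\<^sub>0 nat"
    by (induction V rule: infinite_finite_induct) (simp_all add: mult_single)
  have mono: "A (Poly_Mapping.single m c)" for m c
  proof -
    let ?Q = "\<Prod>v\<in>Poly_Mapping.keys m. mvar v ^ Poly_Mapping.lookup m v"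
    have "(\<Sum>v\<in>Poly_Mapping.keys m. Poly_Mapping.single v (Poly_Mapping.lookup m v)) = m"
      by (rule poly_mapping_eqI) (auto simp: lookup_sum lookup_single when_def in_keys_iff)
    then have "?Q = Poly_Mapping.single m 1" by (simp add: single_pow prod_single)
    then have "Poly_Mapping.single m c = of_int c * ?Q" by (simp add: mult_single flip: single_of_int)
    moreover have "A (of_int c * ?Q)" by (intro mult const prd pow var)
    ultimately show ?thesis by simp
  qed
  have "A (\<Sum>m\<in>M. Poly_Mapping.single m (f m))" for M f
    by (induction M rule: infinite_finite_induct) (auto intro: A0 add mono)
  then show ?thesis by (subst int_mpoly_sum_singles)
qed

lemma prime_dvd_binomial_sum:
  fixes a b :: "'a::comm_ring_1"
  assumes "Factorial_Ring.prime p"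
  shows "of_nat p dvd (a + b) ^ p - (a ^ p + b ^ p)"
proof -
  have p: "p > 0" using assms prime_gt_0_nat by blast
  have "(a + b) ^ p = (\<Sum>k\<le>p. of_nat (p choose k) * a ^ k * b ^ (p - k))" by (rule binomial_ring)
  also have "{..p} = insert 0 (insert p {0<..<p})" using p by auto
  finally have "(a + b) ^ p - (a ^ p + b ^ p)
      = (\<Sum>k\<in>{0<..<p}. of_nat (p choose k) * a ^ k * b ^ (p - k))" using p by simp
  also have "of_nat p dvd \<dots>"
  proof (rule dvd_sum)
    fix k assume "k \<in> {0<..<p}"
    then have "p dvd p choose k" using assms by (intro dvd_choose_prime) auto
    then have "(of_nat p :: 'a) dvd of_nat (p choose k)" by (auto elim!: dvdE)
    then show "of_nat p dvd of_nat (p choose k) * a ^ k * b ^ (p - k)" by (simp add: dvd_mult2)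
  qed
  finally show ?thesis .
qed

locale frobenius_lift =
  fixes p :: nat and \<psi> :: "'a::comm_ring_1 \<Rightarrow> 'a"
  assumes prime_p: "Factorial_Ring.prime p"
    and \<psi>_add: "\<psi> (a + b) = \<psi> a + \<psi> b" and \<psi>_mult: "\<psi> (a * b) = \<psi> a * \<psi> b" and \<psi>_1: "\<psi> 1 = 1"
    and \<psi>_cong: "of_nat p dvd \<psi> a - a ^ p"

text \<open>
  Raising each variable to its \<open>p\<close>-th power agrees with the \<open>p\<close>-th power map modulo \<open>p\<close>, since the
  latter is additive modulo \<open>p\<close> and fixes the integers (Fermat).
\<close>

lemma frobenius_lift_mpoly:
  assumes "Factorial_Ring.prime p"
  shows "frobenius_lift p (mpoly_eval (\<lambda>v. mvar v ^ p) :: 'v int_mpoly \<Rightarrow> 'v int_mpoly)"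
proof
  fix a :: "'v int_mpoly"
  let ?\<psi> = "mpoly_eval (\<lambda>v. mvar v ^ p) :: 'v int_mpoly \<Rightarrow> 'v int_mpoly"
  let ?D = "\<lambda>P. of_nat p dvd ?\<psi> P - P ^ p"
  have add: "?D (P + Q)" if "?D P" "?D Q" for P Q
  proof -
    have "?\<psi> (P + Q) - (P + Q) ^ p
        = ((?\<psi> P - P ^ p) + (?\<psi> Q - Q ^ p)) - ((P + Q) ^ p - (P ^ p + Q ^ p))"
      by (simp add: mpoly_eval_hom)
    also have "of_nat p dvd \<dots>"
      by (rule dvd_diff[OF dvd_add[OF that] prime_dvd_binomial_sum[OF assms]])
    finally show ?thesis .
  qed
  have p: "p > 0" using assms prime_gt_0_nat by blast
  have nat: "?D (of_nat n)" for n
  proof (induction n)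
    case (Suc n)
    then show ?case using add[of "of_nat n" 1] p by (simp add: add.commute)
  qed (use p in \<open>simp add: zero_power\<close>)
  have neg1: "?D (- 1)"
    by (cases "p = 2") (use assms prime_odd_nat[of p] prime_ge_2_nat[of p] in \<open>auto simp: mpoly_eval_hom\<close>)
  show "?D a"
  proof (induction a rule: int_mpoly_induct)
    case (mult P Q)
    have "?\<psi> (P * Q) - (P * Q) ^ p = ?\<psi> P * (?\<psi> Q - Q ^ p) + Q ^ p * (?\<psi> P - P ^ p)"
      by (simp add: mpoly_eval_hom algebra_simps power_mult_distrib)
    also have "of_nat p dvd \<dots>" using mult by (intro dvd_add dvd_mult)
    finally show ?case .
  next
    case (const c)
    show ?case
    proof (induction c)
      case (neg n)
      have "?D (of_nat m * - 1)" for m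
        by (induction m) (use p add neg1 in \<open>simp_all add: zero_power ring_distribs\<close>, metis add neg1 uminus_add_conv_diff add.commute)
      from this[of "Suc n"] show ?case by simp
    qed (use nat in simp)
  qed (use add in simp_all)
qed (simp_all add: mpoly_eval_hom assms)

text \<open>
  The cofactor of \<open>a - b\<close> in \<open>a\<^sup>p - b\<^sup>p\<close> is a sum of \<open>p\<close> terms, each of them congruent to \<open>b\<^sup>p\<^sup>-\<^sup>1\<close>
  modulo \<open>p\<close>; so it contributes one more factor \<open>p\<close>.
\<close>

lemma dvd_power_diff_prime:
  fixes a b :: "'a::comm_ring_1"
  assumes "of_nat p ^ j dvd a - b" "j \<ge> 1"
  shows "of_nat p ^ Suc j dvd a ^ p - b ^ p"
proof -
  have ab: "of_nat p dvd a - b" using assms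
    by (metis One_nat_def dvd_power dvd_trans less_eq_Suc_le)
  have pow: "of_nat p dvd a ^ i - b ^ i" for i
    using ab by (metis dvd_trans dvd_triv_left power_diff_sumr2)
  have "of_nat p dvd (\<Sum>i<p. b ^ (p - Suc i) * a ^ i)"
  proof -
    have "(\<Sum>i<p. b ^ (p - Suc i) * a ^ i)
        = (\<Sum>i<p. b ^ (p - Suc i) * (a ^ i - b ^ i)) + of_nat p * b ^ (p - 1)"
    proof -
      have "(\<Sum>i<p. b ^ (p - Suc i) * b ^ i) = (\<Sum>i<p. b ^ (p - 1))"
        by (intro sum.cong) (auto simp flip: power_add)
      then show ?thesis by (simp add: algebra_simps sum_subtractf)
    qed
    also have "of_nat p dvd \<dots>" by (intro dvd_add dvd_sum dvd_mult pow dvd_triv_left)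
    finally show ?thesis .
  qed
  with assms(1) have "of_nat p ^ j * of_nat p dvd (a - b) * (\<Sum>i<p. b ^ (p - Suc i) * a ^ i)"
    by (rule mult_dvd_mono)
  then show ?thesis by (simp add: power_diff_sumr2 mult.commute)
qed

lemma dvd_prime_power_diff:
  fixes a b :: "'a::comm_ring_1"
  assumes "of_nat p dvd a - b"
  shows "of_nat p ^ Suc i dvd a ^ (p ^ i) - b ^ (p ^ i)"
proof (induction i)
  case (Suc i)
  from dvd_power_diff_prime[OF this] show ?case by (simp add: power_mult[symmetric] mult.commute)
qed (use assms in simp)

section \<open>Ghost vectors over a finite abelian \<open>p\<close>-group\<close>

locale finite_abelian_p_group = comm_group G for G (structure) +
  fixes p n :: nat
  assumes p_prime: "Factorial_Ring.prime p" and order_eq: "Coset.order G = p ^ n"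
begin

lemma p_gt_1: "p > 1"
  using p_prime prime_gt_1_nat by blast

lemma power_p_dvd_iff: "p ^ a dvd p ^ b \<longleftrightarrow> a \<le> b"
  using p_gt_1 power_dvd_imp_le le_imp_power_dvd by blast

lemma finite_carrier: "finite (carrier G)"
  using order_eq p_gt_1 order_gt_0_iff_finite by simp

lemma card_subgroup: assumes "subgroup K G" obtains m where "card K = p ^ m" "m \<le> n"
proof -
  have "card K dvd p ^ n" using lagrange[OF assms] order_eq by (metis dvd_triv_right)
  then show ?thesis using that divides_primepow_nat[OF p_prime] by blast
qed

definition log_ord :: "'a \<Rightarrow> nat" where
  "log_ord g = multiplicity p (ord g)"

lemma ord_eq: assumes "g \<in> carrier G" shows "ord g = p ^ log_ord g"
proof -
  have "ord g dvd p ^ n" using ord_dvd_group_order[OF assms] order_eq by simp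
  then obtain k where "ord g = p ^ k" using divides_primepow_nat[OF p_prime] by blast
  then show ?thesis using p_gt_1 by (simp add: log_ord_def multiplicity_same_power)
qed

lemma pow_eq_one_iff: "g \<in> carrier G \<Longrightarrow> g [^] (p ^ e) = \<one> \<longleftrightarrow> log_ord g \<le> e"
  using p_gt_1 by (simp add: pow_eq_id ord_eq power_p_dvd_iff)

lemma generate_subset_iff: "subgroup K G \<Longrightarrow> g \<in> carrier G \<Longrightarrow> generate G {g} \<subseteq> K \<longleftrightarrow> g \<in> K"
  by (meson empty_subsetI generate.incl generate_subgroup_incl insert_subset singletonI subset_iff)

lemma card_generate: "g \<in> carrier G \<Longrightarrow> card (generate G {g}) = p ^ log_ord g"
  using generate_pow_card ord_eq by metis

lemma card_dvd_card:
  assumes "subgroup K G" "subgroup L G" "K \<subseteq> L" shows "card K dvd card L"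
proof -
  obtain k l where "card K = p ^ k" "card L = p ^ l" using card_subgroup assms by metis
  moreover have "card K \<le> card L"
    using assms finite_carrier by (meson card_mono finite_subset subgroup.subset)
  ultimately show ?thesis using p_gt_1 by (simp add: le_imp_power_dvd)
qed

lemma log_ord_le:
  assumes "subgroup K G" "card K = p ^ m" "g \<in> K" shows "log_ord g \<le> m"
proof -
  have g: "g \<in> carrier G" using assms(1,3) subgroup.mem_carrier by fast
  have "card (generate G {g}) dvd card K"
    using assms g generate_subset_iff by (intro card_dvd_card generate_is_subgroup) auto
  then show ?thesis using assms(2) p_gt_1 g by (simp add: card_generate power_p_dvd_iff)
qed

lemma subgroup_log_ord_le:
  assumes "subgroup K G"
  shows "subgroup {g \<in> K. log_ord g \<le> e} G"
proof (rule subgroupI)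
  have K: "g \<in> carrier G" if "g \<in> K" for g using assms that subgroup.mem_carrier by fast
  show "{g \<in> K. log_ord g \<le> e} \<subseteq> carrier G" using K by auto
  have "\<one> \<in> {g \<in> K. log_ord g \<le> e}"
    using assms subgroup.one_closed pow_eq_one_iff[of \<one> e] by auto
  then show "{g \<in> K. log_ord g \<le> e} \<noteq> {}" by blast
  show "inv g \<in> {g \<in> K. log_ord g \<le> e}" if "g \<in> {g \<in> K. log_ord g \<le> e}" for g
    using that K assms by (auto simp: subgroup.m_inv_closed nat_pow_inv simp flip: pow_eq_one_iff)
  show "g \<otimes> h \<in> {g \<in> K. log_ord g \<le> e}"
    if "g \<in> {g \<in> K. log_ord g \<le> e}" "h \<in> {g \<in> K. log_ord g \<le> e}" for g h
    using that K assms
    by (auto simp: subgroup.m_closed nat_pow_distrib simp flip: pow_eq_one_iff)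
qed

text \<open>
  The elements of \<open>K\<close> killed by \<open>p\<^sup>e\<close> form a subgroup. If \<open>K\<close> has an element of larger order, then a
  power of that element generates a cyclic group of order \<open>p\<^sup>e\<close> in this subgroup. Hence \<open>p\<^sup>e\<close> divides
  the orders of \<open>K\<close> and of the subgroup, and so the cardinality of the complement.
\<close>

lemma dvd_card_log_ord_gt:
  assumes K: "subgroup K G"
  shows "p ^ e dvd card {g \<in> K. e < log_ord g}"
proof (cases "{g \<in> K. e < log_ord g} = {}")
  case False
  then obtain h where h: "h \<in> K" "e < log_ord h" by blast
  have hG: "h \<in> carrier G" using K h(1) subgroup.mem_carrier by fast
  let ?T = "{g \<in> K. log_ord g \<le> e}"
  have T: "subgroup ?T G" by (rule subgroup_log_ord_le[OF K])
  define g where "g = h [^] (p ^ (log_ord h - e))"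
  have g: "g \<in> carrier G" "g \<in> K"
    using hG K h(1) subgroup_int_pow_closed[OF K h(1), of "int (p ^ (log_ord h - e))"]
    by (simp_all add: g_def int_pow_int flip: of_nat_power)
  have "ord g = p ^ log_ord h div p ^ (log_ord h - e)"
    unfolding g_def using hG p_gt_1 h(2) by (subst ord_pow) (simp_all add: ord_eq le_imp_power_dvd)
  also have "\<dots> = p ^ e" using h(2) p_gt_1 by (simp flip: power_diff)
  finally have og: "ord g = p ^ e" .
  then have "log_ord g = e" using ord_eq[OF g(1)] p_gt_1 by simp
  then have "generate G {g} \<subseteq> ?T" using generate_subset_iff[OF T g(1)] g(2) by simp
  then have "card (generate G {g}) dvd card ?T"
    by (intro card_dvd_card T generate_is_subgroup) (use g in auto)
  then have 1: "p ^ e dvd card ?T" using generate_pow_card[OF g(1)] og by simp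
  have "card ?T dvd card K" by (rule card_dvd_card[OF T K]) auto
  then have 2: "p ^ e dvd card K" using 1 dvd_trans by blast
  have "finite K" using K finite_carrier by (meson finite_subset subgroup.subset)
  moreover have "{g \<in> K. e < log_ord g} = K - ?T" by auto
  ultimately have "card {g \<in> K. e < log_ord g} = card K - card ?T"
    by (simp add: card_Diff_subset)
  then show ?thesis using 1 2 by (simp add: dvd_diff_nat)
next
  case True
  then show ?thesis by (metis card.empty dvd_0_right)
qed

text \<open>
  Summation by parts: the increment \<open>f (e + 1) - f e\<close> is counted once for each element of order greater
  than \<open>p\<^sup>e\<close>. There are a multiple of \<open>p\<^sup>e\<close> of these, and the increment supplies the missing factor
  \<open>p\<^sup>m\<^sup>-\<^sup>e\<close>.
\<close>

lemma dvd_sum_log_ord: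
  fixes f :: "nat \<Rightarrow> 'r::comm_ring_1"
  assumes K: "subgroup K G" "card K = p ^ m"
    and f: "\<And>e. e < m \<Longrightarrow> of_nat (p ^ (m - e)) dvd f (Suc e) - f e"
  shows "of_nat (p ^ m) dvd (\<Sum>g\<in>K. f (log_ord g))"
proof -
  have fin: "finite K" using K finite_carrier by (meson finite_subset subgroup.subset)
  have f_eq: "f k = f 0 + (\<Sum>e<m. if e < k then f (Suc e) - f e else 0)" if "k \<le> m" for k
  proof -
    have "(\<Sum>e<m. if e < k then f (Suc e) - f e else 0) = (\<Sum>e<k. f (Suc e) - f e)"
      using that by (intro sum.mono_neutral_cong_right) auto
    then show ?thesis by (simp add: sum_lessThan_telescope)
  qed
  have "(\<Sum>g\<in>K. f (log_ord g))
      = (\<Sum>g\<in>K. f 0 + (\<Sum>e<m. if e < log_ord g then f (Suc e) - f e else 0))"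
    by (intro sum.cong refl f_eq log_ord_le[OF K])
  also have "\<dots> = of_nat (p ^ m) * f 0 + (\<Sum>e<m. \<Sum>g\<in>K. if e < log_ord g then f (Suc e) - f e else 0)"
    by (simp add: sum.distrib K(2) sum.swap[of _ K])
  also have "(\<Sum>e<m. \<Sum>g\<in>K. if e < log_ord g then f (Suc e) - f e else 0)
      = (\<Sum>e<m. of_nat (card {g \<in> K. e < log_ord g}) * (f (Suc e) - f e))"
    by (intro sum.cong refl) (simp add: sum.If_cases[OF fin] Int_def)
  also have "of_nat (p ^ m) dvd of_nat (p ^ m) * f 0 + \<dots>"
  proof (intro dvd_add dvd_triv_left dvd_sum)
    fix e assume "e \<in> {..<m}"
    then have e: "e < m" by simp
    have "(of_nat (p ^ e) :: 'r) dvd of_nat (card {g \<in> K. e < log_ord g})"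
      using dvd_card_log_ord_gt[OF K(1), of e] by (auto elim!: dvdE)
    from mult_dvd_mono[OF this f[OF e]]
    show "of_nat (p ^ m) dvd of_nat (card {g \<in> K. e < log_ord g}) * (f (Suc e) - f e)"
      using e by (simp flip: of_nat_mult power_add)
  qed
  finally show ?thesis .
qed

text \<open>
  This is \<open>|M N| \<le> |G|\<close>, with the product set counted through the cosets of \<open>M\<close> that meet \<open>N\<close>.
\<close>

lemma card_mult_card_le:
  assumes M: "subgroup M G" and N: "subgroup N G"
  shows "card M * card N \<le> Coset.order G * card (M \<inter> N)"
proof -
  have fin: "finite M" "finite N" using M N finite_carrier by (meson finite_subset subgroup.subset)+
  have MG: "M \<subseteq> carrier G" "N \<subseteq> carrier G" using M N subgroup.subset by auto
  have fibre: "card {h \<in> N. M #> h = C} \<le> card (M \<inter> N)" if C: "C \<in> (#>) M ` N" for C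
  proof -
    obtain h0 where h0: "h0 \<in> N" "C = M #> h0" using C by blast
    have "{h \<in> N. M #> h = C} \<subseteq> (\<lambda>x. x \<otimes> h0) ` (M \<inter> N)"
    proof
      fix h assume "h \<in> {h \<in> N. M #> h = C}"
      then have h: "h \<in> N" "M #> h = M #> h0" using h0 by auto
      have c: "h \<in> carrier G" "h0 \<in> carrier G" using h h0 MG by auto
      have "h \<in> M #> h0" using h c rcos_self[OF c(1) M] by simp
      then obtain x where x: "x \<in> M" "h = x \<otimes> h0" by (auto simp: r_coset_def)
      then have xG: "x \<in> carrier G" using MG by auto
      have "x = h \<otimes> inv h0" using x c xG by (simp add: m_assoc)
      then have "x \<in> N" using N h h0 by (simp add: subgroup.m_closed subgroup.m_inv_closed)
      then show "h \<in> (\<lambda>x. x \<otimes> h0) ` (M \<inter> N)" using x by auto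
    qed
    then have "card {h \<in> N. M #> h = C} \<le> card ((\<lambda>x. x \<otimes> h0) ` (M \<inter> N))"
      using fin by (intro card_mono) auto
    also have "\<dots> \<le> card (M \<inter> N)" using fin by (intro card_image_le) auto
    finally show ?thesis .
  qed
  have "card N = (\<Sum>C\<in>(#>) M ` N. card {h \<in> N. M #> h = C})"
    using sum.image_gen[OF fin(2), of "\<lambda>_. 1::nat" "(#>) M"] by simp
  also have "\<dots> \<le> card ((#>) M ` N) * card (M \<inter> N)"
    using sum_bounded_above[of "(#>) M ` N" "\<lambda>C. card {h \<in> N. M #> h = C}"] fibre by simp
  also have "card ((#>) M ` N) \<le> card (rcosets M)"
    using MG finite_carrier by (intro card_mono) (auto simp: RCOSETS_def)
  finally have "card M * card N \<le> (card (rcosets M) * card M) * card (M \<inter> N)" by simp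
  then show ?thesis using lagrange[OF M] by simp
qed

text \<open>
  The Witt polynomial of the \<open>G\<close>-set \<open>G/L\<close>: the quotients of \<open>G/L\<close> are the \<open>G/M\<close> with \<open>L \<subseteq> M\<close>, and
  there are \<open>[G : M]\<close> maps from \<open>G/L\<close> to \<open>G/M\<close> because \<open>G\<close> is abelian.
\<close>

definition ghost :: "'a set \<Rightarrow> ('a set \<Rightarrow> 'r::comm_ring_1) \<Rightarrow> 'r" where
  "ghost L x = (\<Sum>M\<in>{M. subgroup M G \<and> L \<subseteq> M}.
     of_nat (Coset.order G div card M) * x M ^ (card M div card L))"

lemma finite_subgroups: "finite {M. subgroup M G \<and> P M}"
  by (rule finite_subset[of _ "Pow (carrier G)"]) (auto simp: finite_carrier dest: subgroup.subset)

lemma ghost_cong: "(\<And>M. subgroup M G \<Longrightarrow> L \<subseteq> M \<Longrightarrow> x M = y M) \<Longrightarrow> ghost L x = ghost L y"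
  unfolding ghost_def by (intro sum.cong) auto

end

context frobenius_lift
begin

lemma \<psi>_0: "\<psi> 0 = 0" using \<psi>_add[of 0 0] by simp

lemma \<psi>_pow_add: "(\<psi> ^^ k) (a + b) = (\<psi> ^^ k) a + (\<psi> ^^ k) b"
  by (induction k) (simp_all add: \<psi>_add)

lemma \<psi>_pow_mult: "(\<psi> ^^ k) (a * b) = (\<psi> ^^ k) a * (\<psi> ^^ k) b"
  by (induction k) (simp_all add: \<psi>_mult)

lemma \<psi>_pow_0: "(\<psi> ^^ k) 0 = 0"
  by (induction k) (simp_all add: \<psi>_0)

lemma \<psi>_pow_1: "(\<psi> ^^ k) 1 = 1"
  by (induction k) (simp_all add: \<psi>_1)

lemma \<psi>_pow_sum: "(\<psi> ^^ k) (sum f I) = (\<Sum>i\<in>I. (\<psi> ^^ k) (f i))"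
  by (induction I rule: infinite_finite_induct) (simp_all add: \<psi>_pow_add \<psi>_pow_0)

lemma \<psi>_pow_power: "(\<psi> ^^ k) (a ^ i) = (\<psi> ^^ k) a ^ i"
  by (induction i) (simp_all add: \<psi>_pow_mult \<psi>_pow_1)

lemma \<psi>_pow_of_nat: "(\<psi> ^^ k) (of_nat i) = of_nat i"
  by (induction i) (simp_all add: \<psi>_pow_add \<psi>_pow_0 \<psi>_pow_1)

lemma \<psi>_pow_diff: "(\<psi> ^^ k) (a - b) = (\<psi> ^^ k) a - (\<psi> ^^ k) b"
  using \<psi>_pow_add[of k "a - b" b] by (simp add: algebra_simps)

end

locale dwork = finite_abelian_p_group G p n + frobenius_lift p \<psi>
  for G (structure) and p n and \<psi> :: "'r::comm_ring_1 \<Rightarrow> 'r"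
begin

text \<open>
  For \<open>\<psi> = id\<close> on \<open>\<int>\<close> this is Burnside's orbit count for \<open>K\<close> acting on functions from \<open>K\<close> to a set
  of \<open>z\<close> colours: \<open>g\<close> fixes \<open>z\<close> to the power \<open>|K| / ord g\<close> of them. In general, consecutive terms are
  congruent because \<open>\<psi> b \<equiv> b\<^sup>p\<close> modulo \<open>p\<close>, and raising to the power \<open>p\<^sup>i\<close> improves this to a congruence
  modulo \<open>p\<^sup>i\<^sup>+\<^sup>1\<close>.
\<close>

lemma dvd_sum_frobenius_powers:
  assumes K: "subgroup K G"
  shows "of_nat (card K) dvd (\<Sum>g\<in>K. (\<psi> ^^ log_ord g) z ^ (card K div p ^ log_ord g))"
proof -
  obtain m where m: "card K = p ^ m" using card_subgroup[OF K] .
  define f where "f e = (\<psi> ^^ e) z ^ p ^ (m - e)" for e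
  have "of_nat (p ^ (m - e)) dvd f (Suc e) - f e" if "e < m" for e
  proof -
    let ?b = "(\<psi> ^^ e) z"
    have "of_nat p ^ Suc (m - Suc e) dvd \<psi> ?b ^ p ^ (m - Suc e) - (?b ^ p) ^ p ^ (m - Suc e)"
      by (rule dvd_prime_power_diff[OF \<psi>_cong])
    moreover have "Suc (m - Suc e) = m - e" using that by simp
    ultimately show ?thesis
      by (simp add: f_def power_mult[symmetric] flip: power_Suc)
  qed
  from dvd_sum_log_ord[OF K m this]
  have "of_nat (p ^ m) dvd (\<Sum>g\<in>K. f (log_ord g))" .
  also have "(\<Sum>g\<in>K. f (log_ord g)) = (\<Sum>g\<in>K. (\<psi> ^^ log_ord g) z ^ (card K div p ^ log_ord g))"
    unfolding m f_def
    by (intro sum.cong refl) (use log_ord_le[OF K m] p_gt_1 in \<open>simp add: power_diff\<close>)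
  finally show ?thesis using m by simp
qed

text \<open>
  The sum over group elements in the Burnside congruences, twisted by powers of \<open>\<psi>\<close> so that the
  components at cyclic groups of different orders become comparable modulo powers of \<open>p\<close>. Its
  divisibility by the group order makes the coordinate at the trivial subgroup exist.
\<close>

definition cyclic_sum :: "('a set \<Rightarrow> 'r) \<Rightarrow> 'r" where
  "cyclic_sum w = (\<Sum>g\<in>carrier G. (\<psi> ^^ log_ord g) (w (generate G {g})))"

text \<open>
  Expanding both ghost components, the pair \<open>(M, N)\<close> contributes \<open>[G : M] [G : N]\<close> times a sum over
  \<open>M \<inter> N\<close> of the kind treated in \<open>dvd_sum_frobenius_powers\<close>. That sum is divisible by \<open>|M \<inter> N|\<close>, and
  since all orders are powers of \<open>p\<close>, the inequality \<open>|M| |N| \<le> |G| |M \<inter> N|\<close> yields divisibility by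
  \<open>|G|\<close>.
\<close>

lemma dvd_cyclic_sum_ghost_mult:
  "of_nat (Coset.order G) dvd cyclic_sum (\<lambda>L. ghost L x * ghost L y)"
proof -
  let ?S = "{M. subgroup M G}"
  let ?c = "\<lambda>M. Coset.order G div card M"
  let ?t = "\<lambda>M N g. (\<psi> ^^ log_ord g) (of_nat (?c M) * x M ^ (card M div p ^ log_ord g) *
       (of_nat (?c N) * y N ^ (card N div p ^ log_ord g)))"
  \<comment> \<open>On \<open>M \<inter> N\<close> the product of the two powers is a single power of \<open>?z M N\<close>.\<close>
  let ?z = "\<lambda>M N. x M ^ (card M div card (M \<inter> N)) * y N ^ (card N div card (M \<inter> N))"
  have fin: "finite ?S" using finite_subgroups[of "\<lambda>_. True"] by simp
  have gh: "ghost (generate G {g}) u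
      = (\<Sum>M\<in>?S. if g \<in> M then of_nat (?c M) * u M ^ (card M div p ^ log_ord g) else 0)"
    if "g \<in> carrier G" for g and u :: "'a set \<Rightarrow> 'r"
    unfolding ghost_def using that fin
    by (intro sum.mono_neutral_cong_left) (auto simp: generate_subset_iff card_generate)
  have "cyclic_sum (\<lambda>L. ghost L x * ghost L y)
      = (\<Sum>g\<in>carrier G. \<Sum>M\<in>?S. \<Sum>N\<in>?S. if g \<in> M \<inter> N then ?t M N g else 0)"
    unfolding cyclic_sum_def
  proof (intro sum.cong refl)
    fix g assume g: "g \<in> carrier G"
    show "(\<psi> ^^ log_ord g) (ghost (generate G {g}) x * ghost (generate G {g}) y)
        = (\<Sum>M\<in>?S. \<Sum>N\<in>?S. if g \<in> M \<inter> N then ?t M N g else 0)"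
      unfolding gh[OF g] sum_product \<psi>_pow_sum by (intro sum.cong refl) (auto simp: \<psi>_pow_0)
  qed
  also have "\<dots> = (\<Sum>M\<in>?S. \<Sum>N\<in>?S. \<Sum>g\<in>carrier G. if g \<in> M \<inter> N then ?t M N g else 0)"
    by (simp only: sum.swap[of _ "carrier G"])
  also have "of_nat (Coset.order G) dvd \<dots>"
  proof (rule dvd_sum, rule dvd_sum)
    fix M N assume "M \<in> ?S" "N \<in> ?S"
    then have M: "subgroup M G" and N: "subgroup N G" by auto
    have MN: "subgroup (M \<inter> N) G" using M N by (rule subgroups_Inter_pair)
    obtain a where a: "card M = p ^ a" "a \<le> n" using card_subgroup[OF M] .
    obtain b where b: "card N = p ^ b" "b \<le> n" using card_subgroup[OF N] .
    obtain i where i: "card (M \<inter> N) = p ^ i" "i \<le> n" using card_subgroup[OF MN] .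
    have "p ^ i dvd p ^ a" "p ^ i dvd p ^ b"
      using card_dvd_card[OF MN M] card_dvd_card[OF MN N] a b i by auto
    then have ia: "i \<le> a" "i \<le> b" using p_gt_1 by (auto simp: power_p_dvd_iff)
    have "p ^ (a + b) \<le> p ^ (n + i)"
      using card_mult_card_le[OF M N] by (simp add: a b i order_eq power_add)
    then have ab: "a + b \<le> n + i" using p_gt_1 by simp
    have "(\<Sum>g\<in>carrier G. if g \<in> M \<inter> N then ?t M N g else 0) = (\<Sum>g\<in>M \<inter> N. ?t M N g)"
      using finite_carrier subgroup.subset[OF MN] by (intro sum.mono_neutral_cong_right) auto
    also have "\<dots> = of_nat (?c M * ?c N) *
        (\<Sum>g\<in>M \<inter> N. (\<psi> ^^ log_ord g) (?z M N) ^ (card (M \<inter> N) div p ^ log_ord g))"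
      unfolding sum_distrib_left
    proof (intro sum.cong refl)
      fix g assume g: "g \<in> M \<inter> N"
      have gi: "log_ord g \<le> i" by (rule log_ord_le[OF MN i(1) g])
      have e: "card M div p ^ log_ord g = (card M div card (M \<inter> N)) * (card (M \<inter> N) div p ^ log_ord g)"
        "card N div p ^ log_ord g = (card N div card (M \<inter> N)) * (card (M \<inter> N) div p ^ log_ord g)"
        using gi ia p_gt_1 unfolding a b i by (simp_all flip: power_diff power_add)
      show "?t M N g = of_nat (?c M * ?c N) * ((\<psi> ^^ log_ord g) (?z M N) ^ (card (M \<inter> N) div p ^ log_ord g))"
        unfolding e by (simp add: \<psi>_pow_mult \<psi>_pow_power \<psi>_pow_of_nat power_mult power_mult_distrib mult_ac)
    qed
    also have "of_nat (?c M * ?c N * card (M \<inter> N)) dvd \<dots>"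
      unfolding of_nat_mult[of "_ * _" "card _"] by (intro mult_dvd_mono dvd_refl dvd_sum_frobenius_powers MN)
    finally have d: "of_nat (?c M * ?c N * card (M \<inter> N)) dvd
        (\<Sum>g\<in>carrier G. if g \<in> M \<inter> N then ?t M N g else 0)" .
    have "?c M * ?c N * card (M \<inter> N) = p ^ ((n - a) + (n - b) + i)"
    proof -
      have "?c M = p ^ (n - a)" "?c N = p ^ (n - b)"
        using a b p_gt_1 by (simp_all add: order_eq power_diff)
      then show ?thesis by (simp only: i power_add)
    qed
    moreover have "n \<le> (n - a) + (n - b) + i" using ab a b by linarith
    ultimately have "Coset.order G dvd ?c M * ?c N * card (M \<inter> N)"
      by (simp add: order_eq le_imp_power_dvd)
    then have "(of_nat (Coset.order G) :: 'r) dvd of_nat (?c M * ?c N * card (M \<inter> N))" by (metis dvdE dvdI of_nat_mult)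
    then show "of_nat (Coset.order G) dvd (\<Sum>g\<in>carrier G. if g \<in> M \<inter> N then ?t M N g else 0)"
      using d dvd_trans by blast
  qed
  finally show ?thesis .
qed

text \<open>
  The vector with the single coordinate \<open>1\<close> at the point \<open>G/G\<close> is the unit. It makes the congruence for
  ghost vectors a special case of the one for products.
\<close>

lemma ghost_unit:
  assumes "subgroup L G"
  shows "ghost L (\<lambda>M. if M = carrier G then 1 else 0) = (1::'r)"
proof -
  have pos: "card M div card L \<noteq> 0" if "subgroup M G" "L \<subseteq> M" for M
  proof -
    have "finite M" using that finite_carrier by (meson finite_subset subgroup.subset)
    then have "card L \<le> card M" using that card_mono by blast
    moreover have "finite L" using \<open>finite M\<close> that(2) finite_subset by blast
    moreover have "L \<noteq> {}" using assms subgroup.one_closed by blast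
    ultimately show ?thesis by (simp add: div_eq_0_iff card_gt_0_iff)
  qed
  have "ghost L (\<lambda>M. if M = carrier G then 1 else 0 :: 'r)
      = (\<Sum>M\<in>{M. subgroup M G \<and> L \<subseteq> M}. if M = carrier G then 1 else 0)"
    unfolding ghost_def
  proof (intro sum.cong refl)
    fix M assume "M \<in> {M. subgroup M G \<and> L \<subseteq> M}"
    then show "of_nat (Coset.order G div card M) * (if M = carrier G then 1 else 0 :: 'r) ^ (card M div card L)
        = (if M = carrier G then 1 else 0)"
      using pos[of M] order_eq p_gt_1 by (auto simp: Coset.order_def zero_power)
  qed
  also have "\<dots> = 1"
    using finite_subgroups subgroup_self subgroup.subset[OF assms] by (simp add: sum.delta')
  finally show ?thesis .
qed

lemma dvd_cyclic_sum_ghost: "of_nat (Coset.order G) dvd cyclic_sum (\<lambda>L. ghost L x)"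
proof -
  have "cyclic_sum (\<lambda>L. ghost L x)
      = cyclic_sum (\<lambda>L. ghost L x * ghost L (\<lambda>M. if M = carrier G then 1 else 0))"
    unfolding cyclic_sum_def by (intro sum.cong refl) (simp add: ghost_unit generate_is_subgroup)
  then show ?thesis using dvd_cyclic_sum_ghost_mult by simp
qed

lemma dvd_cyclic_sum_ghost_add:
  "of_nat (Coset.order G) dvd cyclic_sum (\<lambda>L. ghost L x + ghost L y)"
  using dvd_add[OF dvd_cyclic_sum_ghost[of x] dvd_cyclic_sum_ghost[of y]]
  by (simp add: cyclic_sum_def \<psi>_pow_add sum.distrib)

text \<open>
  Compare \<open>w\<close> with the ghost vector of \<open>s\<close> whose coordinate at the trivial subgroup is replaced by \<open>0\<close>.
  They agree at all nontrivial subgroups, in particular at \<open>\<langle>g\<rangle>\<close> for \<open>g \<noteq> 1\<close>. So the difference of their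
  cyclic sums is just the difference at the trivial subgroup. It is divisible by \<open>|G|\<close>, which is the
  coefficient of the missing coordinate.
\<close>

lemma ghost_extend:
  assumes w: "of_nat (Coset.order G) dvd cyclic_sum w"
    and eq: "\<And>L. subgroup L G \<Longrightarrow> L \<noteq> {\<one>} \<Longrightarrow> w L = ghost L s"
  shows "\<exists>z. w {\<one>} = ghost {\<one>} (s({\<one>} := z))"
proof -
  let ?s0 = "s({\<one>} := 0)"
  have triv: "subgroup {\<one>} G" by (rule triv_subgroup)
  have one: "\<one> \<in> L" if "subgroup L G" for L using that subgroup.one_closed by blast
  have eq0: "w L = ghost L ?s0" if L: "subgroup L G" "L \<noteq> {\<one>}" for L
    unfolding eq[OF L] using L one by (intro ghost_cong) auto
  have "cyclic_sum w - cyclic_sum (\<lambda>L. ghost L ?s0)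
      = (\<Sum>g\<in>carrier G. (\<psi> ^^ log_ord g) (w (generate G {g}) - ghost (generate G {g}) ?s0))"
    by (simp add: cyclic_sum_def sum_subtractf \<psi>_pow_diff)
  also have "\<dots> = (\<Sum>g\<in>{\<one>}. (\<psi> ^^ log_ord g) (w (generate G {g}) - ghost (generate G {g}) ?s0))"
  proof (rule sum.mono_neutral_right[OF finite_carrier])
    show "\<forall>g\<in>carrier G - {\<one>}. (\<psi> ^^ log_ord g) (w (generate G {g}) - ghost (generate G {g}) ?s0) = 0"
    proof
      fix g assume g: "g \<in> carrier G - {\<one>}"
      then have "g \<in> generate G {g}" by (simp add: generate.incl)
      then have "generate G {g} \<noteq> {\<one>}" using g by blast
      then show "(\<psi> ^^ log_ord g) (w (generate G {g}) - ghost (generate G {g}) ?s0) = 0"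
        using g eq0[of "generate G {g}"] by (simp add: generate_is_subgroup \<psi>_pow_0)
    qed
  qed simp
  also have "\<dots> = w {\<one>} - ghost {\<one>} ?s0"
  proof -
    have "log_ord \<one> = 0" using pow_eq_one_iff[of \<one> 0] by simp
    then show ?thesis by (simp add: generate_one)
  qed
  finally have "of_nat (Coset.order G) dvd w {\<one>} - ghost {\<one>} ?s0"
    using dvd_diff[OF w dvd_cyclic_sum_ghost[of ?s0]] by simp
  then obtain z where z: "w {\<one>} - ghost {\<one>} ?s0 = of_nat (Coset.order G) * z" by (elim dvdE)
  have split: "ghost {\<one>} u = of_nat (Coset.order G) * u {\<one>} +
      (\<Sum>M\<in>{M. subgroup M G \<and> {\<one>} \<subseteq> M} - {{\<one>}}. of_nat (Coset.order G div card M) * u M ^ (card M div card {\<one>}))"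
    for u :: "'a set \<Rightarrow> 'r"
    unfolding ghost_def using triv by (subst sum.remove[of _ "{\<one>}"]) (auto simp: finite_subgroups)
  have "ghost {\<one>} (s({\<one>} := z)) = of_nat (Coset.order G) * z + ghost {\<one>} ?s0"
    unfolding split by (simp add: fun_upd_def)
  then show ?thesis using z by (intro exI[of _ z]) (simp add: algebra_simps)
qed

end

section \<open>Transitive sets over an abelian group\<close>

text \<open>
  For an abelian group the kernel of a transitive action is the stabilizer of every point. Working with
  the kernel avoids the choice of a base point.
\<close>

definition kernel_of :: "('g, 'm) monoid_scheme \<Rightarrow> ('g, 'x) gset \<Rightarrow> 'g set" where
  "kernel_of G S = {g \<in> carrier G. \<forall>x\<in>fst S. snd S g x = x}"

abbreviation trans_gset :: "('g, 'm) monoid_scheme \<Rightarrow> ('g, 'x) gset \<Rightarrow> bool" where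
  "trans_gset G S \<equiv> transitive_action G (fst S) (snd S) \<and> fst S \<noteq> {}"

context comm_group
begin

lemma trans_gset_kernel_iff:
  assumes S: "trans_gset G S" and x: "x \<in> fst S" and g: "g \<in> carrier G"
  shows "g \<in> kernel_of G S \<longleftrightarrow> snd S g x = x"
proof -
  interpret transitive_action G "fst S" "snd S" using S by blast
  have "snd S g y = y" if fixed: "snd S g x = x" and y: "y \<in> fst S" for y
  proof -
    obtain h where h: "h \<in> carrier G" "snd S h x = y" using unique_orbit x y by blast
    have "snd S g y = snd S (g \<otimes> h) x" using composition_rule[OF x g h(1)] h by simp
    also have "\<dots> = snd S (h \<otimes> g) x" using g h by (simp add: m_comm)
    also have "\<dots> = y" using composition_rule[OF x h(1) g] h fixed by simp
    finally show ?thesis .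
  qed
  then show ?thesis using x g by (auto simp: kernel_of_def)
qed

lemma trans_gset_kernel_eq:
  assumes "trans_gset G S" "x \<in> fst S"
  shows "kernel_of G S = stabilizer G (snd S) x"
  using trans_gset_kernel_iff[OF assms] by (auto simp: stabilizer_def kernel_of_def)

lemma subgroup_kernel_of:
  assumes S: "trans_gset G S" shows "subgroup (kernel_of G S) G"
proof -
  interpret transitive_action G "fst S" "snd S" using S by blast
  obtain x where x: "x \<in> fst S" using S by blast
  show ?thesis using stabilizer_subgroup[OF x] trans_gset_kernel_eq[OF S x] by simp
qed

lemma card_gset:
  assumes S: "trans_gset G S" shows "card (fst S) = card (rcosets (kernel_of G S))"
proof -
  interpret transitive_action G "fst S" "snd S" using S by blast
  obtain x where x: "x \<in> fst S" using S by blast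
  have "orbit G (snd S) x = fst S"
    using unique_orbit x element_image by (fastforce simp: orbit_def)
  then show ?thesis
    using bij_betw_same_card[OF orbit_stab_fun_is_bij[OF x]] trans_gset_kernel_eq[OF S x] by simp
qed

lemma same_image_iff:
  assumes S: "trans_gset G S" and x: "x \<in> fst S" and g: "g \<in> carrier G" "h \<in> carrier G"
  shows "snd S g x = snd S h x \<longleftrightarrow> inv h \<otimes> g \<in> kernel_of G S"
proof -
  interpret transitive_action G "fst S" "snd S" using S by blast
  have "snd S (inv h \<otimes> g) x = snd S (inv h) (snd S g x)" using composition_rule x g by simp
  then have "inv h \<otimes> g \<in> kernel_of G S \<longleftrightarrow> snd S (inv h) (snd S g x) = x"
    using trans_gset_kernel_iff[OF S x, of "inv h \<otimes> g"] g by simp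
  also have "\<dots> \<longleftrightarrow> snd S g x = snd S h x"
    using orbit_sym_aux[OF g(2) x] orbit_sym_aux[of "inv h" "snd S g x" x] element_image[OF g(1) x] g by auto
  finally show ?thesis by blast
qed

lemma gset_maps_iff:
  "f \<in> gset_maps G S T \<longleftrightarrow> f \<in> fst S \<rightarrow>\<^sub>E fst T \<and>
     (\<forall>g\<in>carrier G. \<forall>x\<in>fst S. f (snd S g x) = snd T g (f x))"
  by (simp add: gset_maps_def case_prod_unfold)

lemma gset_maps_imp_kernel_subset:
  assumes S: "trans_gset G S" and T: "trans_gset G T" and f: "f \<in> gset_maps G S T"
  shows "kernel_of G S \<subseteq> kernel_of G T"
proof
  fix g assume g: "g \<in> kernel_of G S"
  obtain x where x: "x \<in> fst S" using S by blast
  have gc: "g \<in> carrier G" using g by (simp add: kernel_of_def)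
  have "snd T g (f x) = f (snd S g x)" using f gc x by (simp add: gset_maps_iff)
  also have "\<dots> = f x" using g x by (simp add: kernel_of_def)
  finally show "g \<in> kernel_of G T"
    using trans_gset_kernel_iff[OF T _ gc, of "f x"] f x by (auto simp: gset_maps_iff)
qed

text \<open>
  A map out of a transitive \<open>G\<close>-set is determined by the image of one point \<open>x\<close>. An arbitrary image \<open>y\<close>
  is possible because the stabilizer of \<open>x\<close> is contained in that of \<open>y\<close>.
\<close>

lemma gset_maps_bij_eval:
  assumes S: "trans_gset G S" and T: "trans_gset G T" and x: "x \<in> fst S"
    and sub: "kernel_of G S \<subseteq> kernel_of G T"
  shows "bij_betw (\<lambda>f. f x) (gset_maps G S T) (fst T)"
proof -
  interpret S: transitive_action G "fst S" "snd S" using S by blast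
  interpret T: transitive_action G "fst T" "snd T" using T by blast
  have mov: "\<exists>g. g \<in> carrier G \<and> snd S g x = z" if "z \<in> fst S" for z
    using S.unique_orbit x that by blast
  show ?thesis
    unfolding bij_betw_def
  proof
    show "inj_on (\<lambda>f. f x) (gset_maps G S T)"
    proof (rule inj_onI)
      fix f f' assume f: "f \<in> gset_maps G S T" "f' \<in> gset_maps G S T" "f x = f' x"
      show "f = f'"
      proof (rule extensionalityI[of _ "fst S"])
        fix z assume "z \<in> fst S"
        then obtain g where "g \<in> carrier G" "snd S g x = z" using mov by blast
        then show "f z = f' z" using f x by (auto simp: gset_maps_iff)
      qed (use f in \<open>auto simp: gset_maps_iff PiE_def\<close>)
    qed
    show "(\<lambda>f. f x) ` gset_maps G S T = fst T"
    proof
      show "(\<lambda>f. f x) ` gset_maps G S T \<subseteq> fst T" using x by (auto simp: gset_maps_iff)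
      show "fst T \<subseteq> (\<lambda>f. f x) ` gset_maps G S T"
      proof
        fix y assume y: "y \<in> fst T"
        define c where "c z = (SOME g. g \<in> carrier G \<and> snd S g x = z)" for z
        have c: "c z \<in> carrier G" "snd S (c z) x = z" if "z \<in> fst S" for z
          using someI_ex[OF mov[OF that]] by (simp_all add: c_def)
        define f where "f = (\<lambda>z\<in>fst S. snd T (c z) y)"
        have f: "f (snd S g x) = snd T g y" if g: "g \<in> carrier G" for g
        proof -
          have z: "snd S g x \<in> fst S" using S.element_image[OF g x] by simp
          have "inv g \<otimes> c (snd S g x) \<in> kernel_of G S"
            using same_image_iff[OF S x c(1)[OF z] g] c(2)[OF z] by simp
          then have "snd T (c (snd S g x)) y = snd T g y"
            using same_image_iff[OF T y c(1)[OF z] g] sub by blast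
          then show ?thesis using z by (simp add: f_def)
        qed
        have fx: "f x = y"
          using f[of \<one>] S.id_eq_one T.id_eq_one x y by (metis one_closed restrict_apply')
        have "f \<in> gset_maps G S T"
          unfolding gset_maps_iff
        proof (intro conjI ballI)
          show "f \<in> fst S \<rightarrow>\<^sub>E fst T"
            using c(1) T.element_image[OF _ y] by (auto simp: f_def)
          fix g z assume g: "g \<in> carrier G" and z: "z \<in> fst S"
          have "f (snd S g z) = f (snd S (g \<otimes> c z) x)"
            using S.composition_rule[OF x g c(1)[OF z]] c(2)[OF z] by simp
          also have "\<dots> = snd T (g \<otimes> c z) y" using f g c(1)[OF z] by simp
          also have "\<dots> = snd T g (f z)"
            using T.composition_rule[OF y g c(1)[OF z]] z by (simp add: f_def)
          finally show "f (snd S g z) = snd T g (f z)" .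
        qed
        then show "y \<in> (\<lambda>f. f x) ` gset_maps G S T" using fx by blast
      qed
    qed
  qed
qed

lemma gset_maps_nonempty_iff:
  assumes S: "trans_gset G S" and T: "trans_gset G T"
  shows "gset_maps G S T \<noteq> {} \<longleftrightarrow> kernel_of G S \<subseteq> kernel_of G T"
proof
  assume "kernel_of G S \<subseteq> kernel_of G T"
  moreover obtain x where "x \<in> fst S" using S by blast
  ultimately show "gset_maps G S T \<noteq> {}"
    using gset_maps_bij_eval[OF S T] T by (fastforce simp: bij_betw_def)
qed (use gset_maps_imp_kernel_subset[OF S T] in blast)

lemma card_gset_maps:
  assumes "trans_gset G S" "trans_gset G T" "kernel_of G S \<subseteq> kernel_of G T"
  shows "card (gset_maps G S T) = card (fst T)"
proof -
  obtain x where "x \<in> fst S" using assms(1) by blast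
  then show ?thesis using gset_maps_bij_eval[OF assms(1,2) _ assms(3)] bij_betw_same_card by blast
qed

lemma gset_iso_iff_kernel_eq:
  assumes S: "trans_gset G S" "finite (fst S)" and T: "trans_gset G T" "finite (fst T)"
  shows "gset_iso G S T \<longleftrightarrow> kernel_of G S = kernel_of G T"
proof
  assume "gset_iso G S T"
  then obtain f where f: "f \<in> gset_maps G S T" "bij_betw f (fst S) (fst T)"
    by (auto simp: gset_iso_def)
  interpret S: transitive_action G "fst S" "snd S" using S by blast
  have "kernel_of G T \<subseteq> kernel_of G S"
  proof
    fix g assume g: "g \<in> kernel_of G T"
    then have gc: "g \<in> carrier G" by (simp add: kernel_of_def)
    obtain x where x: "x \<in> fst S" using S by blast
    then have "f (snd S g x) = f x" using f g gc by (auto simp: gset_maps_iff kernel_of_def)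
    then have "snd S g x = x"
      using f(2) S.element_image[OF gc x] x by (auto simp: bij_betw_def dest: inj_onD)
    then show "g \<in> kernel_of G S" using trans_gset_kernel_iff[OF S(1) x gc] by simp
  qed
  then show "kernel_of G S = kernel_of G T" using gset_maps_imp_kernel_subset[OF S(1) T(1) f(1)] by blast
next
  assume eq: "kernel_of G S = kernel_of G T"
  then obtain f where f: "f \<in> gset_maps G S T" using gset_maps_nonempty_iff[OF S(1) T(1)] by blast
  interpret S: transitive_action G "fst S" "snd S" using S by blast
  interpret T: transitive_action G "fst T" "snd T" using T by blast
  obtain x where x: "x \<in> fst S" using S by blast
  have fE: "f \<in> fst S \<rightarrow> fst T" using f by (auto simp: gset_maps_iff)
  have "fst T \<subseteq> f ` fst S"
  proof
    fix y assume "y \<in> fst T"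
    then obtain g where g: "g \<in> carrier G" "snd T g (f x) = y" using T.unique_orbit fE x by blast
    then have "f (snd S g x) = y" using f x by (simp add: gset_maps_iff)
    then show "y \<in> f ` fst S" using S.element_image[OF g(1) x] by blast
  qed
  then have "f ` fst S = fst T" using fE by blast
  moreover have "card (fst S) = card (fst T)" using card_gset[OF S(1)] card_gset[OF T(1)] eq by simp
  ultimately have "bij_betw f (fst S) (fst T)"
    using S(2) by (simp add: bij_betw_def eq_card_imp_inj_on)
  then show "gset_iso G S T" using f by (auto simp: gset_iso_def)
qed

lemma set_mult_coset_of_smaller:
  assumes K: "subgroup K G" and H: "subgroup H G" "H \<subseteq> K" and g: "g \<in> carrier G"
  shows "K <#> (H #> g) = K #> g"
proof -
  have "K <#> H = K"
  proof
    show "K <#> H \<subseteq> K" using K H by (auto simp: set_mult_def subgroup.m_closed)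
    show "K \<subseteq> K <#> H"
    proof
      fix k assume k: "k \<in> K"
      then have "k = k \<otimes> \<one>" using subgroup.mem_carrier[OF K k] by simp
      then show "k \<in> K <#> H" using k subgroup.one_closed[OF H(1)] unfolding set_mult_def by blast
    qed
  qed
  then show ?thesis using setmult_rcos_assoc[of K H g] g subgroup.subset[OF K] subgroup.subset[OF H(1)] by simp
qed

lemma image_rcosets_of_smaller:
  assumes K: "subgroup K G" and H: "subgroup H G" "H \<subseteq> K"
  shows "(\<lambda>C. K <#> C) ` (rcosets H) = rcosets K"
  unfolding RCOSETS_def using set_mult_coset_of_smaller[OF assms] by (auto simp: image_UN)

definition coset_gset :: "'a set \<Rightarrow> ('a, 'a set) gset" where
  "coset_gset H = (rcosets H, \<lambda>g. \<lambda>C\<in>rcosets H. (H #> g) <#> C)"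

lemma coset_gset:
  assumes H: "subgroup H G"
  shows "trans_gset G (coset_gset H)" "kernel_of G (coset_gset H) = H"
proof -
  interpret normal H G using H by (rule subgroup_imp_normal)
  interpret Q: comm_group "G Mod H" by (rule abelian_FactGroup[OF H])
  have car: "carrier (G Mod H) = rcosets H" by (simp add: FactGroup_def)
  have mul: "C <#> D = C \<otimes>\<^bsub>G Mod H\<^esub> D" for C D by simp
  have mem: "H #> g \<in> rcosets H" if "g \<in> carrier G" for g
    using that by (simp add: rcosetsI subset)
  let ?\<phi> = "\<lambda>g. \<lambda>C\<in>rcosets H. (H #> g) <#> C"
  have bij: "?\<phi> g \<in> Bij (rcosets H)" if g: "g \<in> carrier G" for g
  proof -
    have "bij_betw (?\<phi> g) (rcosets H) (rcosets H)"
    proof (rule bij_betwI[where g = "\<lambda>C. (H #> inv g) <#> C"])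
      show "?\<phi> g \<in> rcosets H \<rightarrow> rcosets H" "(\<lambda>C. (H #> inv g) <#> C) \<in> rcosets H \<rightarrow> rcosets H"
        using Q.m_closed mem g by (auto simp: car)
      have inv: "(H #> g) <#> (H #> inv g) = H" "(H #> inv g) <#> (H #> g) = H"
        using g by (simp_all add: rcos_sum subset)
      show "(H #> inv g) <#> ?\<phi> g C = C" if "C \<in> rcosets H" for C
        using that Q.m_assoc[of "H #> inv g" "H #> g" C] inv g mem Q.l_one[of C] by (simp add: car)
      show "?\<phi> g ((H #> inv g) <#> C) = C" if "C \<in> rcosets H" for C
        using that Q.m_assoc[of "H #> g" "H #> inv g" C] inv g mem Q.l_one[of C]
          Q.m_closed[of "H #> inv g" C] by (simp add: car)
    qed
    then show ?thesis by (auto simp: Bij_def)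
  qed
  have "group_hom G (BijGroup (rcosets H)) ?\<phi>"
  proof (intro group_hom.intro group_hom_axioms.intro)
    show "?\<phi> \<in> hom G (BijGroup (rcosets H))"
    proof (rule homI)
      fix g assume "g \<in> carrier G"
      then show "?\<phi> g \<in> carrier (BijGroup (rcosets H))" using bij by (simp add: BijGroup_def)
    next
      fix g h assume gh: "g \<in> carrier G" "h \<in> carrier G"
      have "?\<phi> (g \<otimes> h) = compose (rcosets H) (?\<phi> g) (?\<phi> h)"
      proof (rule extensionalityI[of _ "rcosets H"])
        fix C assume C: "C \<in> rcosets H"
        have "(H #> (g \<otimes> h)) <#> C = (H #> g) <#> ((H #> h) <#> C)"
          using gh C mem Q.m_assoc[of "H #> g" "H #> h" C] by (simp add: car rcos_sum)
        moreover have "(H #> h) <#> C \<in> rcosets H" using Q.m_closed[of "H #> h" C] gh C mem by (simp add: car)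
        ultimately show "?\<phi> (g \<otimes> h) C = compose (rcosets H) (?\<phi> g) (?\<phi> h) C"
          using C by (simp add: compose_eq)
      qed auto
      then show "?\<phi> (g \<otimes> h) = ?\<phi> g \<otimes>\<^bsub>BijGroup (rcosets H)\<^esub> ?\<phi> h"
        using bij[OF gh(1)] bij[OF gh(2)] by (simp add: BijGroup_def)
    qed
  qed (use group_BijGroup is_group in auto)
  moreover have "\<exists>g\<in>carrier G. ?\<phi> g C = D" if CD: "C \<in> rcosets H" "D \<in> rcosets H" for C D
  proof -
    have "D \<otimes>\<^bsub>G Mod H\<^esub> inv\<^bsub>G Mod H\<^esub> C \<in> rcosets H" using CD Q.m_closed Q.inv_closed by (metis car)
    then obtain g where g: "g \<in> carrier G" "D \<otimes>\<^bsub>G Mod H\<^esub> inv\<^bsub>G Mod H\<^esub> C = H #> g"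
      by (auto simp: RCOSETS_def)
    have "(H #> g) \<otimes>\<^bsub>G Mod H\<^esub> C = D"
      unfolding g(2)[symmetric] using CD Q.inv_closed[of C] Q.m_assoc[of D "inv\<^bsub>G Mod H\<^esub> C" C] Q.l_inv[of C] Q.r_one[of D]
      unfolding car by simp
    then show ?thesis using g CD by auto
  qed
  ultimately have "transitive_action G (rcosets H) ?\<phi>"
    by (simp add: transitive_action_def group_action_def transitive_action_axioms_def)
  moreover have HC: "H \<in> rcosets H" by (rule subgroup_in_rcosets[OF is_group])
  ultimately show trans: "trans_gset G (coset_gset H)" by (auto simp: coset_gset_def)
  have "g \<in> kernel_of G (coset_gset H) \<longleftrightarrow> g \<in> H" if g: "g \<in> carrier G" for g
  proof -
    have "(H #> g) <#> H = H #> g" using Q.r_one[of "H #> g"] mem[OF g] by (simp add: car)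
    then have "g \<in> kernel_of G (coset_gset H) \<longleftrightarrow> H #> g = H"
      using trans_gset_kernel_iff[OF trans _ g, of H] HC by (simp add: coset_gset_def)
    also have "\<dots> \<longleftrightarrow> g \<in> H"
      using g H coset_join1 coset_join2 subset by blast
    finally show ?thesis .
  qed
  then show "kernel_of G (coset_gset H) = H" using subset by (auto simp: kernel_of_def)
qed

end

locale top_abelian_group = comm_group G for G (structure) +
  fixes \<tau> :: "'a topology"
  assumes topspace_eq: "topspace \<tau> = carrier G"
begin

lemma fdt_gsetD:
  assumes "fdt_gset G \<tau> S" shows "trans_gset G S" "finite (fst S)"
  using assms by (auto simp: fdt_gset_def case_prod_unfold)

text \<open>
  The orbit map \<open>g \<mapsto> g x\<close> is continuous into a discrete space, and \<open>B\<close> is the preimage of \<open>B x\<close>.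
\<close>

lemma openin_kernel_invariant:
  assumes S: "fdt_gset G \<tau> S" and B: "B \<subseteq> carrier G"
    and inv: "\<And>b h. b \<in> B \<Longrightarrow> h \<in> kernel_of G S \<Longrightarrow> b \<otimes> h \<in> B"
  shows "openin \<tau> B"
proof -
  note S' = fdt_gsetD[OF S]
  interpret transitive_action G "fst S" "snd S" using S' by blast
  obtain x where x: "x \<in> fst S" using S' by blast
  have "continuous_map \<tau> (prod_topology \<tau> (discrete_topology (fst S))) (\<lambda>g. (g, x))"
    using x by (intro continuous_map_pairedI) auto
  moreover have "continuous_map (prod_topology \<tau> (discrete_topology (fst S)))
      (discrete_topology (fst S)) (\<lambda>(g, x). snd S g x)"
    using S by (auto simp: fdt_gset_def case_prod_unfold)
  ultimately have "continuous_map \<tau> (discrete_topology (fst S)) ((\<lambda>(g, x). snd S g x) \<circ> (\<lambda>g. (g, x)))"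
    by (rule continuous_map_compose)
  then have "openin \<tau> {g \<in> topspace \<tau>. ((\<lambda>(g, x). snd S g x) \<circ> (\<lambda>g. (g, x))) g \<in> (\<lambda>b. snd S b x) ` B}"
    by (rule openin_continuous_map_preimage) (use element_image x B in auto)
  moreover have "{g \<in> topspace \<tau>. ((\<lambda>(g, x). snd S g x) \<circ> (\<lambda>g. (g, x))) g \<in> (\<lambda>b. snd S b x) ` B} = B"
  proof safe
    fix g b assume g: "g \<in> topspace \<tau>" "((\<lambda>(g, x). snd S g x) \<circ> (\<lambda>g. (g, x))) g = snd S b x" and b: "b \<in> B"
    have c: "g \<in> carrier G" "b \<in> carrier G" using g b B topspace_eq by auto
    have "inv b \<otimes> g \<in> kernel_of G S" using same_image_iff[OF S'(1) x c] g by simp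
    from inv[OF b this] show "g \<in> B" using c by (simp flip: m_assoc)
  qed (use B topspace_eq in auto)
  ultimately show ?thesis by simp
qed

lemma fdt_coset_gset:
  assumes H: "subgroup H G" and fin: "finite (rcosets H)"
    and op: "\<And>C. C \<in> rcosets H \<Longrightarrow> openin \<tau> C"
  shows "fdt_gset G \<tau> (coset_gset H)"
proof -
  note S = coset_gset(1)[OF H]
  let ?S = "coset_gset H"
  interpret transitive_action G "fst ?S" "snd ?S" using S by blast
  have fst: "fst ?S = rcosets H" by (simp add: coset_gset_def)
  have opn: "openin \<tau> {g \<in> carrier G. snd ?S g C = D}" if C: "C \<in> rcosets H" for C D
  proof (subst openin_subopen, intro ballI)
    fix g assume g: "g \<in> {g \<in> carrier G. snd ?S g C = D}"
    have "H #> g \<subseteq> {g \<in> carrier G. snd ?S g C = D}"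
    proof
      fix h assume "h \<in> H #> g"
      then obtain a where a: "a \<in> H" "h = a \<otimes> g" by (auto simp: r_coset_def)
      have ac: "a \<in> carrier G" using a H subgroup.mem_carrier by fast
      then have "inv g \<otimes> h \<in> kernel_of G ?S"
        using a g coset_gset(2)[OF H] by (simp add: m_lcomm)
      moreover have "h \<in> carrier G" using a ac g by simp
      ultimately show "h \<in> {g \<in> carrier G. snd ?S g C = D}"
        using same_image_iff[OF S, of C h g] C g fst by simp
    qed
    moreover have "g \<in> H #> g" using g rcos_self H by simp
    moreover have "openin \<tau> (H #> g)" using op g H by (simp add: rcosetsI subgroup.subset)
    ultimately show "\<exists>U. openin \<tau> U \<and> g \<in> U \<and> U \<subseteq> {g \<in> carrier G. snd ?S g C = D}" by blast
  qed
  have "continuous_map (prod_topology \<tau> (discrete_topology (rcosets H))) (discrete_topology (rcosets H))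
      (\<lambda>(g, x). snd ?S g x)"
    unfolding continuous_map_def
  proof (intro conjI allI impI)
    show "(\<lambda>(g, x). snd ?S g x) \<in> topspace (prod_topology \<tau> (discrete_topology (rcosets H))) \<rightarrow> topspace (discrete_topology (rcosets H))"
      using element_image by (auto simp: topspace_eq fst)
    fix U
    have "{y \<in> topspace (prod_topology \<tau> (discrete_topology (rcosets H))). (case y of (g, x) \<Rightarrow> snd ?S g x) \<in> U}
        = (\<Union>C\<in>rcosets H. \<Union>D\<in>U. {g \<in> carrier G. snd ?S g C = D} \<times> {C})"
      by (auto simp: topspace_eq)
    moreover have "openin (prod_topology \<tau> (discrete_topology (rcosets H))) \<dots>"
      using opn by (intro openin_Union ballI) (auto simp: openin_prod_Times_iff)
    ultimately show "openin (prod_topology \<tau> (discrete_topology (rcosets H)))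
        {y \<in> topspace (prod_topology \<tau> (discrete_topology (rcosets H))). (case y of (g, x) \<Rightarrow> snd ?S g x) \<in> U}"
      by simp
  qed
  then show ?thesis using S fin fst by (simp add: fdt_gset_def case_prod_unfold)
qed

text \<open>
  Isomorphism classes thus correspond to kernels, and the order between classes becomes the reverse
  inclusion of kernels (\<open>class_le_iff\<close>).
\<close>

lemma gset_iso_rel_eq:
  "gset_iso_rel G \<tau> = {(S, T). fdt_gset G \<tau> S \<and> fdt_gset G \<tau> T \<and> kernel_of G S = kernel_of G T}"
proof -
  have "gset_iso G S T \<longleftrightarrow> kernel_of G S = kernel_of G T"
    if "fdt_gset G \<tau> S" "fdt_gset G \<tau> T" for S T :: "('a, 'a set) gset"
    using gset_iso_iff_kernel_eq fdt_gsetD that by metis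
  then show ?thesis by (auto simp: gset_iso_rel_def)
qed

definition stab :: "'a gclass \<Rightarrow> 'a set" where
  "stab T = kernel_of G (rep T)"

lemma frame_rep:
  assumes "T \<in> frame G \<tau>"
  shows "fdt_gset G \<tau> (rep T)" "S \<in> T \<longleftrightarrow> fdt_gset G \<tau> S \<and> kernel_of G S = stab T"
proof -
  obtain S0 where S: "fdt_gset G \<tau> S0" "T = gset_iso_rel G \<tau> `` {S0}"
    using assms unfolding frame_def by (elim quotientE) simp
  have mem: "S' \<in> T \<longleftrightarrow> fdt_gset G \<tau> S' \<and> kernel_of G S' = kernel_of G S0" for S'
    unfolding S(2) gset_iso_rel_eq using S(1) by auto
  have "rep T \<in> T" unfolding rep_def by (rule someI[of "\<lambda>t. t \<in> T" S0]) (simp add: mem S(1))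
  then have rep: "fdt_gset G \<tau> (rep T)" "kernel_of G S0 = stab T"
    unfolding mem stab_def by simp_all
  show "fdt_gset G \<tau> (rep T)" by (rule rep(1))
  show "S \<in> T \<longleftrightarrow> fdt_gset G \<tau> S \<and> kernel_of G S = stab T" using mem rep(2) by simp
qed

lemma frame_trans: "T \<in> frame G \<tau> \<Longrightarrow> trans_gset G (rep T)"
  using frame_rep(1) fdt_gsetD by blast

lemma subgroup_stab: "T \<in> frame G \<tau> \<Longrightarrow> subgroup (stab T) G"
  unfolding stab_def by (rule subgroup_kernel_of[OF frame_trans])

lemma stab_inject: "T \<in> frame G \<tau> \<Longrightarrow> U \<in> frame G \<tau> \<Longrightarrow> stab T = stab U \<longleftrightarrow> T = U"
  using frame_rep(2)[of T] frame_rep(2)[of U] by (auto intro: set_eqI)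

lemma class_of_gset:
  assumes "fdt_gset G \<tau> S"
  shows "gset_iso_rel G \<tau> `` {S} \<in> frame G \<tau>" "stab (gset_iso_rel G \<tau> `` {S}) = kernel_of G S"
proof -
  show fr: "gset_iso_rel G \<tau> `` {S} \<in> frame G \<tau>"
    using assms by (auto simp: frame_def intro: quotientI)
  have "S \<in> gset_iso_rel G \<tau> `` {S}" using assms by (simp add: gset_iso_rel_eq)
  then show "stab (gset_iso_rel G \<tau> `` {S}) = kernel_of G S" using frame_rep(2)[OF fr, of S] by simp
qed

lemma csize_eq: "T \<in> frame G \<tau> \<Longrightarrow> csize T = card (rcosets (stab T))"
  unfolding csize_def stab_def by (rule card_gset[OF frame_trans])

lemma csize_pos: "T \<in> frame G \<tau> \<Longrightarrow> csize T > 0"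
  unfolding csize_def using fdt_gsetD[OF frame_rep(1)] by (metis card_gt_0_iff)

lemma finite_rcosets_stab: "T \<in> frame G \<tau> \<Longrightarrow> finite (rcosets (stab T))"
  using csize_pos csize_eq card_gt_0_iff by metis

lemma class_le_iff:
  "T \<in> frame G \<tau> \<Longrightarrow> U \<in> frame G \<tau> \<Longrightarrow> class_le G U T \<longleftrightarrow> stab T \<subseteq> stab U"
  unfolding class_le_def stab_def by (rule gset_maps_nonempty_iff[OF frame_trans frame_trans])

lemma num_maps_eq:
  "T \<in> frame G \<tau> \<Longrightarrow> U \<in> frame G \<tau> \<Longrightarrow> class_le G U T \<Longrightarrow> num_maps G T U = csize U"
  using card_gset_maps[OF frame_trans frame_trans, of T U]
  by (simp add: class_le_iff num_maps_def csize_def stab_def)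

text \<open>
  Every subgroup above an open kernel is again a kernel: its cosets are unions of cosets of the smaller
  one, hence open and finite in number.
\<close>

lemma exists_class_above:
  assumes T: "T \<in> frame G \<tau>" and K: "subgroup K G" "stab T \<subseteq> K"
  obtains U where "U \<in> frame G \<tau>" "stab U = K"
proof -
  have KG: "K \<subseteq> carrier G" using K subgroup.subset by blast
  have "rcosets K = (\<lambda>C. K <#> C) ` (rcosets (stab T))"
    using image_rcosets_of_smaller[OF K(1) subgroup_stab[OF T] K(2)] by simp
  then have fin: "finite (rcosets K)" using finite_rcosets_stab[OF T] by simp
  have "openin \<tau> C" if C: "C \<in> rcosets K" for C
  proof (rule openin_kernel_invariant[OF frame_rep(1)[OF T]])
    show "C \<subseteq> carrier G" using subgroup.rcosets_carrier[OF K(1) is_group C] .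
    obtain g where g: "g \<in> carrier G" "C = K #> g" using C by (auto simp: RCOSETS_def)
    fix b h assume b: "b \<in> C" and h: "h \<in> kernel_of G (rep T)"
    then obtain k where k: "k \<in> K" "b = k \<otimes> g" using g by (auto simp: r_coset_def)
    have hK: "h \<in> K" using h K by (auto simp: stab_def)
    have "b \<otimes> h = (k \<otimes> h) \<otimes> g" using k hK KG g by (simp add: subset_iff m_ac)
    moreover have "k \<otimes> h \<in> K" using k hK K by (simp add: subgroup.m_closed)
    ultimately show "b \<otimes> h \<in> C" unfolding g(2) by (auto simp: r_coset_def)
  qed
  then show ?thesis
    using class_of_gset[OF fdt_coset_gset[OF K(1) fin]] coset_gset(2)[OF K(1)] that by metis
qed

lemma fdt_trivial: "fdt_gset G \<tau> ({carrier G}, \<lambda>g. \<lambda>x\<in>{carrier G}. x)"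
proof -
  let ?E = "{carrier G}"
  have id: "(\<lambda>x\<in>?E. x) \<in> Bij ?E" by (auto simp: Bij_def bij_betw_def)
  have comp: "compose ?E (\<lambda>x\<in>?E. x) (\<lambda>x\<in>?E. x) = (\<lambda>x\<in>?E. x)"
    by (rule extensionalityI[of _ ?E]) (auto simp: compose_eq)
  have "group_hom G (BijGroup ?E) (\<lambda>g. \<lambda>x\<in>?E. x)"
  proof (intro group_hom.intro group_hom_axioms.intro homI)
    show "(\<lambda>x\<in>?E. x) \<in> carrier (BijGroup ?E)" using id by (simp add: BijGroup_def)
    show "(\<lambda>x\<in>?E. x) = (\<lambda>x\<in>?E. x) \<otimes>\<^bsub>BijGroup ?E\<^esub> (\<lambda>x\<in>?E. x)"
      using id comp by (simp add: BijGroup_def)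
  qed (use group_BijGroup is_group in auto)
  then have "transitive_action G ?E (\<lambda>g. \<lambda>x\<in>?E. x)"
    unfolding transitive_action_def group_action_def transitive_action_axioms_def using one_closed by auto
  moreover have "continuous_map (prod_topology \<tau> (discrete_topology ?E)) (discrete_topology ?E)
      (\<lambda>(g, x). (\<lambda>x\<in>?E. x) x)"
    by (rule continuous_map_eq[OF continuous_map_snd]) (auto simp: case_prod_unfold)
  ultimately show ?thesis unfolding fdt_gset_def prod.case by blast
qed

lemma trivial_class_in_frame: "trivial_class G \<tau> \<in> frame G \<tau>"
  unfolding trivial_class_def by (rule class_of_gset(1)[OF fdt_trivial])

lemma stab_trivial_class: "stab (trivial_class G \<tau>) = carrier G"
  unfolding trivial_class_def by (subst class_of_gset(2)[OF fdt_trivial]) (simp add: kernel_of_def)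

end

section \<open>Existence and uniqueness of the Witt addition and multiplication polynomials\<close>

context comm_group
begin

definition quot :: "'a set \<Rightarrow> 'a set \<Rightarrow> 'a set set" where
  "quot H K = (\<lambda>g. H #> g) ` K"

context
  fixes H assumes H: "subgroup H G"
begin

lemma coset_in_quot_iff:
  assumes K: "subgroup K G" "H \<subseteq> K" and g: "g \<in> carrier G"
  shows "H #> g \<in> quot H K \<longleftrightarrow> g \<in> K"
proof
  assume "H #> g \<in> quot H K"
  then obtain k where k: "k \<in> K" "H #> g = H #> k" by (auto simp: quot_def)
  have "g \<in> H #> k" using rcos_self[OF g H] k by simp
  then show "g \<in> K" using k K by (auto simp: r_coset_def intro: subgroup.m_closed)
qed (simp add: quot_def)

lemma quot_subset_iff:
  assumes K: "subgroup K G" "H \<subseteq> K" and L: "subgroup L G" "H \<subseteq> L"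
  shows "quot H K \<subseteq> quot H L \<longleftrightarrow> K \<subseteq> L"
proof
  assume sub: "quot H K \<subseteq> quot H L"
  show "K \<subseteq> L"
  proof
    fix g assume g: "g \<in> K"
    then have "H #> g \<in> quot H L" using sub by (auto simp: quot_def)
    then show "g \<in> L" using coset_in_quot_iff[OF L subgroup.mem_carrier[OF K(1) g]] by simp
  qed
qed (auto simp: quot_def)

lemma subgroup_quot:
  assumes K: "subgroup K G"
  shows "subgroup (quot H K) (G Mod H)"
proof -
  interpret normal H G using H by (rule subgroup_imp_normal)
  interpret h: group_hom G "G Mod H" "\<lambda>g. H #> g"
    by (intro group_hom.intro group_hom_axioms.intro is_group factorgroup_is_group r_coset_hom_Mod)
  show ?thesis unfolding quot_def by (rule h.subgroup_img_is_subgroup[OF K])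
qed

lemma subgroup_Mod_is_quot:
  assumes A: "subgroup A (G Mod H)"
  obtains K where "subgroup K G" "H \<subseteq> K" "A = quot H K"
proof
  interpret normal H G using H by (rule subgroup_imp_normal)
  have eq: "\<Union>A = {x \<in> carrier G. H #> x \<in> A}" by (rule factgroup_subgroup_union_char[OF A])
  show "subgroup (\<Union>A) G" by (rule factgroup_subgroup_union_subgroup[OF A])
  show "H \<subseteq> \<Union>A" using subgroup.one_closed[OF A] by auto
  show "A = quot H (\<Union>A)"
    unfolding quot_def eq using subgroup.subset[OF A] by (auto simp: carrier_FactGroup)
qed

text \<open>
  The formula \<open>[G : K] [K : H] = [G : H]\<close> for a possibly infinite \<open>G\<close>: the map \<open>H g \<mapsto> K g\<close> has fibres
  that are cosets of \<open>K/H\<close> in \<open>G/H\<close>.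
\<close>

lemma card_rcosets_mult_card_quot:
  assumes K: "subgroup K G" "H \<subseteq> K" and fin: "finite (rcosets H)"
  shows "card (rcosets K) * card (quot H K) = card (rcosets H)"
proof -
  interpret normal H G using H by (rule subgroup_imp_normal)
  interpret Q: comm_group "G Mod H" by (rule abelian_FactGroup[OF H])
  have car: "carrier (G Mod H) = rcosets H" by (simp add: FactGroup_def)
  have KG: "K \<subseteq> carrier G" using K subgroup.subset by blast
  note KH = set_mult_coset_of_smaller[OF K(1) H K(2)]
  note img = image_rcosets_of_smaller[OF K(1) H K(2)]
  have fibre: "card {C \<in> rcosets H. K <#> C = D} = card (quot H K)" if D: "D \<in> rcosets K" for D
  proof -
    obtain g where g: "g \<in> carrier G" "D = K #> g" using D by (auto simp: RCOSETS_def)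
    have gH: "H #> g \<in> carrier (G Mod H)" using g by (simp add: car rcosetsI subset)
    have "{C \<in> rcosets H. K <#> C = D} = quot H K #>\<^bsub>G Mod H\<^esub> (H #> g)"
    proof (intro equalityI subsetI)
      fix C assume "C \<in> {C \<in> rcosets H. K <#> C = D}"
      then have C: "C \<in> rcosets H" "D = K <#> C" by auto
      then obtain x where x: "x \<in> carrier G" "C = H #> x" by (auto simp: RCOSETS_def)
      have "K #> x = K #> g" using C g KH x by simp
      then have "x \<in> K #> g" using rcos_self[OF x(1) K(1)] by simp
      then obtain k where k: "k \<in> K" "x = k \<otimes> g" by (auto simp: r_coset_def)
      have "C = (H #> k) \<otimes>\<^bsub>G Mod H\<^esub> (H #> g)" using x k g KG by (auto simp: rcos_sum)
      then show "C \<in> quot H K #>\<^bsub>G Mod H\<^esub> (H #> g)" using k by (auto simp: r_coset_def[of "G Mod H"] quot_def)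
    next
      fix C assume "C \<in> quot H K #>\<^bsub>G Mod H\<^esub> (H #> g)"
      then obtain k where k: "k \<in> K" "C = (H #> k) \<otimes>\<^bsub>G Mod H\<^esub> (H #> g)"
        by (auto simp: r_coset_def[of "G Mod H"] quot_def)
      have kG: "k \<in> carrier G" using k KG by auto
      have C: "C = H #> (k \<otimes> g)" using k kG g by (simp add: rcos_sum)
      have "C \<in> rcosets H" unfolding C using kG g by (simp add: rcosetsI subset)
      moreover have "K <#> C = D"
      proof -
        have "K <#> C = K #> (k \<otimes> g)" unfolding C using KH kG g by simp
        also have "\<dots> = K #> k #> g" using KG kG g by (simp add: coset_mult_assoc)
        also have "K #> k = K" using coset_join2[OF kG K(1) k(1)] .
        finally show ?thesis using g by simp
      qed
      ultimately show "C \<in> {C \<in> rcosets H. K <#> C = D}" by simp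
    qed
    also have "card \<dots> = card (quot H K)"
    proof (rule Q.card_rcosets_equal[symmetric])
      show "quot H K #>\<^bsub>G Mod H\<^esub> (H #> g) \<in> rcosets\<^bsub>G Mod H\<^esub> (quot H K)"
        using gH subgroup.subset[OF subgroup_quot[OF K(1)]] by (intro Q.rcosetsI)
    qed (use subgroup.subset[OF subgroup_quot[OF K(1)]] in auto)
    finally show ?thesis .
  qed
  have "card (rcosets H) = (\<Sum>D\<in>rcosets K. card {C \<in> rcosets H. K <#> C = D})"
    using sum.image_gen[OF fin, of "\<lambda>_. 1::nat" "\<lambda>C. K <#> C"] unfolding img by simp
  also have "\<dots> = card (rcosets K) * card (quot H K)" using fibre by simp
  finally show ?thesis by simp
qed

end

end

text \<open>
  The last assumption says that all elements of the finite quotients \<open>G / stab T\<close> have \<open>p\<close>-power order;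
  by Cauchy's theorem these quotients are then \<open>p\<close>-groups (\<open>quotient_p_group\<close>).
\<close>

locale abelian_pro_p_group = top_abelian_group G \<tau> for G (structure) and \<tau> +
  fixes p :: nat
  assumes prime_p: "Factorial_Ring.prime p"
    and pro_p: "T \<in> frame G \<tau> \<Longrightarrow> g \<in> carrier G \<Longrightarrow> \<exists>N::nat. g [^] (p ^ N) \<in> stab T"
begin

lemma p_gt_1: "p > 1" using prime_p prime_gt_1_nat by blast

lemma quotient_p_group:
  assumes T: "T \<in> frame G \<tau>"
  obtains n where "finite_abelian_p_group (G Mod stab T) p n" "csize T = p ^ n"
proof -
  interpret normal "stab T" G using subgroup_stab[OF T] by (rule subgroup_imp_normal)
  interpret Q: comm_group "G Mod stab T" by (rule abelian_FactGroup[OF subgroup_stab[OF T]])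
  have ord: "Coset.order (G Mod stab T) = csize T"
    using csize_eq[OF T] by (simp add: Coset.order_def FactGroup_def)
  have pow: "\<exists>N::nat. C [^]\<^bsub>G Mod stab T\<^esub> (p ^ N) = \<one>\<^bsub>G Mod stab T\<^esub>"
    if C: "C \<in> carrier (G Mod stab T)" for C
  proof -
    obtain g where g: "g \<in> carrier G" "C = stab T #> g" using C by (auto simp: carrier_FactGroup)
    obtain N :: nat where N: "g [^] (p ^ N) \<in> stab T" using pro_p[OF T g(1)] by blast
    have "C [^]\<^bsub>G Mod stab T\<^esub> (p ^ N) = stab T #> (g [^] (p ^ N))"
      using g by (simp add: FactGroup_pow)
    also have "\<dots> = stab T" using N g coset_join2 subgroup_stab[OF T] by simp
    finally show ?thesis by auto
  qed
  have "\<exists>n. csize T = p ^ n"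
  proof (rule ccontr)
    \<comment> \<open>A subgroup of prime order \<open>q \<noteq> p\<close> would contain an element whose order divides \<open>q\<close> and a power of \<open>p\<close>.\<close>
    assume "\<nexists>n. csize T = p ^ n"
    then obtain q where q: "Factorial_Ring.prime q" "q dvd csize T" "q \<noteq> p"
      using Ex_other_prime_factor[of "csize T" p] csize_pos[OF T] prime_p by (auto simp: prime_factors_dvd)
    then obtain m where m: "Coset.order (G Mod stab T) = q ^ 1 * m" using ord by (auto elim: dvdE)
    have "finite (carrier (G Mod stab T))"
      using finite_rcosets_stab[OF T] by (simp add: FactGroup_def)
    then obtain H where H: "subgroup H (G Mod stab T)" "card H = q"
      using sylow_thm[OF q(1) Q.is_group m] by auto
    have "\<not> card H \<le> 1" using H(2) prime_gt_1_nat[OF q(1)] by simp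
    then have "\<not> H \<subseteq> {\<one>\<^bsub>G Mod stab T\<^esub>}"
      using card_mono[of "{\<one>\<^bsub>G Mod stab T\<^esub>}" H] by auto
    then obtain C where C: "C \<in> H" "C \<noteq> \<one>\<^bsub>G Mod stab T\<^esub>" by blast
    have Cc: "C \<in> carrier (G Mod stab T)" using subgroup.subset[OF H(1)] C by blast
    interpret HH: group "(G Mod stab T)\<lparr>carrier := H\<rparr>" by (rule Q.subgroup_imp_group[OF H(1)])
    have "C [^]\<^bsub>(G Mod stab T)\<lparr>carrier := H\<rparr>\<^esub> q = \<one>\<^bsub>G Mod stab T\<^esub>"
      using HH.pow_order_eq_1[of C] C H(2) by (simp add: Coset.order_def)
    then have "C [^]\<^bsub>G Mod stab T\<^esub> q = \<one>\<^bsub>G Mod stab T\<^esub>"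
      using Q.nat_pow_consistent by metis
    then have 1: "Q.ord C dvd q" using Q.pow_eq_id[OF Cc] by blast
    obtain N where "C [^]\<^bsub>G Mod stab T\<^esub> (p ^ N) = \<one>\<^bsub>G Mod stab T\<^esub>" using pow[OF Cc] by blast
    then have 2: "Q.ord C dvd p ^ N" using Q.pow_eq_id[OF Cc] by blast
    have "coprime q (p ^ N)" using primes_coprime[OF q(1) prime_p q(3)] by simp
    then have "Q.ord C = 1" using 1 2 by (metis coprime_common_divisor_nat)
    then show False using Q.ord_eq_1[OF Cc] C by simp
  qed
  then obtain n where n: "csize T = p ^ n" ..
  have "finite_abelian_p_group (G Mod stab T) p n"
    by (intro finite_abelian_p_group.intro finite_abelian_p_group_axioms.intro Q.comm_group_axioms prime_p)
      (use ord n in simp)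
  then show ?thesis using n that by blast
qed

definition lower :: "'a gclass \<Rightarrow> 'a gclass set" where
  "lower T = {U \<in> frame G \<tau>. class_le G U T}"

lemma lower_iff: "T \<in> frame G \<tau> \<Longrightarrow> U \<in> lower T \<longleftrightarrow> U \<in> frame G \<tau> \<and> stab T \<subseteq> stab U"
  by (auto simp: lower_def class_le_iff)

lemma lower_trans: "T \<in> frame G \<tau> \<Longrightarrow> U \<in> lower T \<Longrightarrow> V \<in> lower U \<Longrightarrow> V \<in> lower T"
  by (auto simp: lower_iff)

lemma self_in_lower: "T \<in> frame G \<tau> \<Longrightarrow> T \<in> lower T"
  by (simp add: lower_iff)

abbreviation qt :: "'a gclass \<Rightarrow> 'a gclass \<Rightarrow> 'a set set" where
  "qt T U \<equiv> quot (stab T) (stab U)"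

text \<open>
  The classes below \<open>T\<close> are its quotients, and these correspond to the subgroups of the finite group \<open>G / stab T\<close>.
  This reduces all questions about \<open>W\<^sub>T\<close> to that group.
\<close>

lemma bij_betw_qt:
  assumes T: "T \<in> frame G \<tau>"
  shows "bij_betw (qt T) (lower T) {M. subgroup M (G Mod stab T)}"
  unfolding bij_betw_def
proof
  show "inj_on (qt T) (lower T)"
  proof (rule inj_onI)
    fix U V assume UV: "U \<in> lower T" "V \<in> lower T" "qt T U = qt T V"
    then have "stab U = stab V"
      using quot_subset_iff[OF subgroup_stab[OF T], of "stab U" "stab V"]
        quot_subset_iff[OF subgroup_stab[OF T], of "stab V" "stab U"]
        subgroup_stab[of U] subgroup_stab[of V] lower_iff[OF T] by blast
    then show "U = V" using UV stab_inject lower_iff[OF T] by blast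
  qed
  show "qt T ` lower T = {M. subgroup M (G Mod stab T)}"
  proof safe
    fix U assume "U \<in> lower T"
    then show "subgroup (qt T U) (G Mod stab T)"
      using subgroup_quot[OF subgroup_stab[OF T] subgroup_stab] lower_iff[OF T] by blast
  next
    fix M assume "subgroup M (G Mod stab T)"
    then obtain K where K: "subgroup K G" "stab T \<subseteq> K" "M = quot (stab T) K"
      using subgroup_Mod_is_quot[OF subgroup_stab[OF T]] by metis
    obtain U where "U \<in> frame G \<tau>" "stab U = K" using exists_class_above[OF T K(1,2)] .
    then show "M \<in> qt T ` lower T" using K lower_iff[OF T] by blast
  qed
qed

lemma card_qt:
  assumes T: "T \<in> frame G \<tau>" and U: "U \<in> lower T"
  shows "csize U * card (qt T U) = csize T"
  using card_rcosets_mult_card_quot[OF subgroup_stab[OF T], of "stab U"] U finite_rcosets_stab[OF T]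
  by (simp add: csize_eq T lower_iff[OF T] subgroup_stab)

lemma qt_self:
  assumes T: "T \<in> frame G \<tau>" shows "qt T T = {\<one>\<^bsub>G Mod stab T\<^esub>}"
proof -
  have "stab T #> g = stab T" if "g \<in> stab T" for g
    using coset_join2[OF _ subgroup_stab[OF T] that] subgroup.mem_carrier[OF subgroup_stab[OF T] that] by simp
  moreover have "\<one> \<in> stab T" using subgroup.one_closed[OF subgroup_stab[OF T]] .
  ultimately show ?thesis by (auto simp: quot_def)
qed

lemma finite_lower:
  assumes T: "T \<in> frame G \<tau>" shows "finite (lower T)"
proof -
  obtain n where "finite_abelian_p_group (G Mod stab T) p n" using quotient_p_group[OF T] .
  then interpret Q: finite_abelian_p_group "G Mod stab T" p n .
  show ?thesis using bij_betw_finite[OF bij_betw_qt[OF T]] Q.finite_subgroups[of "\<lambda>_. True"] by simp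
qed

lemma witt_poly_eq:
  assumes T: "T \<in> frame G \<tau>"
  shows "witt_poly G \<tau> T x = (\<Sum>U\<in>lower T. of_nat (csize U) * x U ^ (csize T div csize U))"
  unfolding witt_poly_def lower_def by (intro sum.cong refl) (simp add: num_maps_eq T)

definition proper_part :: "'a gclass \<Rightarrow> ('a gclass \<Rightarrow> 'r::comm_ring_1) \<Rightarrow> 'r" where
  "proper_part T x = (\<Sum>U\<in>lower T - {T}. of_nat (csize U) * x U ^ (csize T div csize U))"

lemma witt_poly_split:
  assumes T: "T \<in> frame G \<tau>"
  shows "witt_poly G \<tau> T x = of_nat (csize T) * x T + proper_part T x"
  unfolding witt_poly_eq[OF T] proper_part_def
  using finite_lower[OF T] self_in_lower[OF T] csize_pos[OF T] by (subst sum.remove[of _ T]) auto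

lemma proper_part_cong: "(\<And>U. U \<in> lower T - {T} \<Longrightarrow> x U = y U) \<Longrightarrow> proper_part T x = proper_part T y"
  unfolding proper_part_def by (intro sum.cong) auto

lemma csize_less:
  assumes T: "T \<in> frame G \<tau>" and U: "U \<in> lower T - {T}"
  shows "csize U < csize T"
proof -
  have U': "U \<in> lower T" "U \<in> frame G \<tau>" using U lower_iff[OF T] by auto
  have "subgroup (qt T U) (G Mod stab T)" using bij_betw_qt[OF T] U' by (auto simp: bij_betw_def)
  then have one: "\<one>\<^bsub>G Mod stab T\<^esub> \<in> qt T U" by (rule subgroup.one_closed)
  have "qt T U \<noteq> qt T T"
    using bij_betw_qt[OF T] U self_in_lower[OF T] by (auto simp: bij_betw_def dest: inj_onD)
  then have ne: "qt T U \<noteq> {\<one>\<^bsub>G Mod stab T\<^esub>}" using qt_self[OF T] by simp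
  have pos: "card (qt T U) \<noteq> 0" using card_qt[OF T U'(1)] csize_pos[OF T] by (metis less_irrefl mult_0_right)
  have "card (qt T U) \<noteq> 1" using one ne by (auto simp: card_1_singleton_iff)
  then show ?thesis using pos card_qt[OF T U'(1)] csize_pos[OF U'(2)]
    by (metis One_nat_def le_neq_implies_less less_one linorder_not_le mult.right_neutral nat_mult_less_cancel1)
qed

lemma witt_poly_eq_ghost:
  assumes T: "T \<in> frame G \<tau>" and U: "U \<in> lower T" and fin: "finite_abelian_p_group (G Mod stab T) p n"
    and x': "\<And>V. V \<in> lower T \<Longrightarrow> x' (qt T V) = x V"
  shows "witt_poly G \<tau> U x = finite_abelian_p_group.ghost (G Mod stab T) (qt T U) x'"
proof -
  interpret Q: finite_abelian_p_group "G Mod stab T" p n by (rule fin)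
  have UF: "U \<in> frame G \<tau>" using U lower_iff[OF T] by blast
  have ord: "Coset.order (G Mod stab T) = csize T"
    using csize_eq[OF T] by (simp add: Coset.order_def FactGroup_def)
  have inj: "inj_on (qt T) (lower U)"
    using bij_betw_qt[OF T] lower_trans[OF T U] by (auto simp: bij_betw_def intro: inj_on_subset)
  have sub: "qt T U \<subseteq> qt T V \<longleftrightarrow> stab U \<subseteq> stab V" if "V \<in> lower T" for V
    using quot_subset_iff[OF subgroup_stab[OF T], of "stab U" "stab V"] U that
    by (simp add: lower_iff[OF T] subgroup_stab)
  have img: "qt T ` lower U = {M. subgroup M (G Mod stab T) \<and> qt T U \<subseteq> M}"
  proof safe
    fix V assume V: "V \<in> lower U"
    then have VT: "V \<in> lower T" using lower_trans[OF T U] by blast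
    then show "subgroup (qt T V) (G Mod stab T)" using bij_betw_qt[OF T] by (auto simp: bij_betw_def)
    fix C assume "C \<in> qt T U"
    then show "C \<in> qt T V" using sub[OF VT] V lower_iff[OF UF] by blast
  next
    fix M assume M: "subgroup M (G Mod stab T)" "qt T U \<subseteq> M"
    then have "M \<in> qt T ` lower T" using bij_betw_imp_surj_on[OF bij_betw_qt[OF T]] by simp
    then obtain V where V: "V \<in> lower T" "M = qt T V" by blast
    then have "V \<in> lower U" using sub[OF V(1)] M lower_iff[OF UF] lower_iff[OF T] by blast
    then show "M \<in> qt T ` lower U" using V by blast
  qed
  show ?thesis
    unfolding witt_poly_eq[OF UF] Q.ghost_def img[symmetric] sum.reindex[OF inj] comp_def
  proof (intro sum.cong refl)
    fix V assume V: "V \<in> lower U"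
    then have VT: "V \<in> lower T" using lower_trans[OF T U] by blast
    have VF: "V \<in> frame G \<tau>" using VT lower_iff[OF T] by blast
    note cV = card_qt[OF T VT] and cU = card_qt[OF T U]
    have pos: "card (qt T V) > 0" "card (qt T U) > 0"
      using cV cU csize_pos[OF T] by (metis gr0I less_irrefl mult_0_right)+
    have 1: "Coset.order (G Mod stab T) div card (qt T V) = csize V"
      using cV pos unfolding ord by (metis less_irrefl nonzero_mult_div_cancel_right)
    have "csize V * card (quot (stab U) (stab V)) = csize U" by (rule card_qt[OF UF V])
    then have r: "csize U = csize V * card (qt U V)" by simp
    have "csize V * (card (qt U V) * card (qt T U)) = csize V * card (qt T V)"
      using cU cV r by (simp add: mult.assoc)
    then have "card (qt T V) = card (qt U V) * card (qt T U)" using csize_pos[OF VF] by simp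
    then have 2: "csize U div csize V = card (qt T V) div card (qt T U)"
      using r pos csize_pos[OF VF] by simp
    show "of_nat (csize V) * x V ^ (csize U div csize V) =
        of_nat (Coset.order (G Mod stab T) div card (qt T V)) * x' (qt T V) ^ (card (qt T V) div card (qt T U))"
      unfolding 1 2 x'[OF VT] ..
  qed
qed

text \<open>
  One step of the recursion. In \<open>G / stab T\<close> the class \<open>T\<close> itself corresponds to the trivial subgroup, so
  that \<open>ghost_extend\<close> applies.
\<close>

lemma witt_extend:
  fixes x y s :: "'a gclass \<Rightarrow> 'r::comm_ring_1"
  assumes T: "T \<in> frame G \<tau>" and lift: "frobenius_lift p (\<psi> :: 'r \<Rightarrow> 'r)"
    and op: "op = (+) \<or> op = (*)"
    and s: "\<And>U. U \<in> lower T - {T} \<Longrightarrow> witt_poly G \<tau> U s = op (witt_poly G \<tau> U x) (witt_poly G \<tau> U y)"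
  shows "\<exists>z. witt_poly G \<tau> T (s(T := z)) = op (witt_poly G \<tau> T x) (witt_poly G \<tau> T y)"
proof -
  obtain n where fin: "finite_abelian_p_group (G Mod stab T) p n" using quotient_p_group[OF T] .
  interpret Q: dwork "G Mod stab T" p n \<psi>
    by (intro dwork.intro fin lift)
  \<comment> \<open>\<open>c\<close> re-indexes vectors on the frame by subgroups of the quotient.\<close>
  define c where "c = inv_into (lower T) (qt T)"
  have c: "c (qt T V) = V" if "V \<in> lower T" for V
    unfolding c_def using bij_betw_qt[OF T] that by (intro inv_into_f_f) (auto simp: bij_betw_def)
  have gh: "witt_poly G \<tau> U u = Q.ghost (qt T U) (\<lambda>M. u (c M))" if "U \<in> lower T" for U and u :: "'a gclass \<Rightarrow> 'r"
    by (rule witt_poly_eq_ghost[OF T that fin]) (simp add: c)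
  let ?w = "\<lambda>L. op (Q.ghost L (\<lambda>M. x (c M))) (Q.ghost L (\<lambda>M. y (c M)))"
  have "of_nat (Coset.order (G Mod stab T)) dvd Q.cyclic_sum ?w"
    using op Q.dvd_cyclic_sum_ghost_add Q.dvd_cyclic_sum_ghost_mult by auto
  moreover have "?w L = Q.ghost L (\<lambda>M. s (c M))" if L: "subgroup L (G Mod stab T)" "L \<noteq> {\<one>\<^bsub>G Mod stab T\<^esub>}" for L
  proof -
    have "L \<in> qt T ` lower T" using L bij_betw_imp_surj_on[OF bij_betw_qt[OF T]] by simp
    then obtain U where U: "U \<in> lower T" "L = qt T U" by blast
    then have "U \<in> lower T - {T}" using L(2) qt_self[OF T] by auto
    from s[OF this] show ?thesis using gh U by simp
  qed
  ultimately obtain z where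
    z: "?w {\<one>\<^bsub>G Mod stab T\<^esub>} = Q.ghost {\<one>\<^bsub>G Mod stab T\<^esub>} ((\<lambda>M. s (c M))({\<one>\<^bsub>G Mod stab T\<^esub>} := z))"
    using Q.ghost_extend[of ?w "\<lambda>M. s (c M)"] by blast
  have "witt_poly G \<tau> T (s(T := z)) = Q.ghost (qt T T) ((\<lambda>M. s (c M))({\<one>\<^bsub>G Mod stab T\<^esub>} := z))"
  proof (rule witt_poly_eq_ghost[OF T self_in_lower[OF T] fin])
    fix V assume V: "V \<in> lower T"
    have "qt T V = {\<one>\<^bsub>G Mod stab T\<^esub>} \<longleftrightarrow> V = T"
      using qt_self[OF T] c[OF V] c[OF self_in_lower[OF T]] by metis
    then show "((\<lambda>M. s (c M))({\<one>\<^bsub>G Mod stab T\<^esub>} := z)) (qt T V) = (s(T := z)) V"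
      using c[OF V] by simp
  qed
  also have "\<dots> = ?w (qt T T)" using z qt_self[OF T] by simp
  also have "\<dots> = op (witt_poly G \<tau> T x) (witt_poly G \<tau> T y)"
    using gh[OF self_in_lower[OF T]] by simp
  finally show ?thesis by blast
qed

text \<open>
  The coordinates are chosen by recursion along proper quotients, which are smaller in size. The Witt
  polynomial of \<open>T\<close> sees the earlier choices only through the classes below \<open>T\<close>.
\<close>

lemma witt_solution_exists:
  fixes x y :: "'a gclass \<Rightarrow> 'r::comm_ring_1"
  assumes lift: "frobenius_lift p (\<psi> :: 'r \<Rightarrow> 'r)" and op: "op = (+) \<or> op = (*)"
  shows "\<exists>S\<in>extensional (frame G \<tau>). \<forall>T\<in>frame G \<tau>.
           op (witt_poly G \<tau> T x) (witt_poly G \<tau> T y) = witt_poly G \<tau> T S"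
proof -
  let ?w = "\<lambda>T. op (witt_poly G \<tau> T x) (witt_poly G \<tau> T y)"
  define R where "R = {(U, T). T \<in> frame G \<tau> \<and> U \<in> lower T - {T}}"
  define P where "P f T r \<longleftrightarrow> (T \<in> frame G \<tau> \<longrightarrow> witt_poly G \<tau> T (f(T := r)) = ?w T)" for f T r
  have "wf R"
  proof (rule wf_subset[OF wf_measure[of csize]])
    show "R \<subseteq> Wellfounded.measure csize" unfolding R_def using csize_less by fastforce
  qed
  then have "\<exists>f. \<forall>T. P f T (f T)"
  proof (rule dependent_wf_choice)
    fix f g :: "'a gclass \<Rightarrow> 'r" and T r
    assume fg: "\<And>U. (U, T) \<in> R \<Longrightarrow> f U = g U"
    have "witt_poly G \<tau> T (f(T := r)) = witt_poly G \<tau> T (g(T := r))" if T: "T \<in> frame G \<tau>"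
      unfolding witt_poly_split[OF T] using proper_part_cong[of T "f(T := r)" "g(T := r)"] fg T
      by (simp add: R_def)
    then show "P f T r = P g T r" by (auto simp: P_def)
  next
    fix T and f :: "'a gclass \<Rightarrow> 'r"
    assume f: "\<And>U. (U, T) \<in> R \<Longrightarrow> P f U (f U)"
    show "\<exists>r. P f T r"
    proof (cases "T \<in> frame G \<tau>")
      case True
      have "witt_poly G \<tau> U f = ?w U" if "U \<in> lower T - {T}" for U
        using f[of U] that True by (simp add: R_def P_def lower_def)
      from witt_extend[OF True lift op this] show ?thesis by (simp add: P_def)
    qed (simp add: P_def)
  qed
  then obtain f where f: "\<And>T. T \<in> frame G \<tau> \<Longrightarrow> witt_poly G \<tau> T f = ?w T" by (auto simp: P_def)
  have "witt_poly G \<tau> T (restrict f (frame G \<tau>)) = witt_poly G \<tau> T f" for T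
    unfolding witt_poly_def by (intro sum.cong refl) simp
  then show ?thesis using f by (intro bexI[of _ "restrict f (frame G \<tau>)"]) auto
qed

text \<open>
  \<open>W\<^sub>T\<close> determines the coordinate at \<open>T\<close> from the smaller ones, since its coefficient \<open>#T\<close> is not a zero
  divisor.
\<close>

lemma witt_poly_inject:
  fixes f g :: "'a gclass \<Rightarrow> 'v int_mpoly"
  assumes ext: "f \<in> extensional (frame G \<tau>)" "g \<in> extensional (frame G \<tau>)"
    and eq: "\<And>T. T \<in> frame G \<tau> \<Longrightarrow> witt_poly G \<tau> T f = witt_poly G \<tau> T g"
  shows "f = g"
proof (rule extensionalityI[OF ext])
  fix T assume "T \<in> frame G \<tau>"
  then show "f T = g T"
  proof (induction "csize T" arbitrary: T rule: less_induct)
    case less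
    note T = \<open>T \<in> frame G \<tau>\<close>
    have "proper_part T f = proper_part T g"
      using less csize_less[OF T] by (intro proper_part_cong) (auto simp: lower_def)
    then have "of_nat (csize T) * f T = of_nat (csize T) * g T"
      using eq[OF T] by (simp add: witt_poly_split[OF T])
    then show ?case using of_nat_mult_cancel_mpoly csize_pos[OF T] by blast
  qed
qed

lemma witt_op_polys:
  assumes op: "op = (+) \<or> op = ((*) :: ('a gclass + 'a gclass) int_mpoly \<Rightarrow> _)"
    and def: "P = (THE S. S \<in> extensional (frame G \<tau>) \<and> (\<forall>T\<in>frame G \<tau>.
      op (witt_poly G \<tau> T (\<lambda>U. mvar (Inl U))) (witt_poly G \<tau> T (\<lambda>U. mvar (Inr U))) = witt_poly G \<tau> T S))"
    and T: "T \<in> frame G \<tau>"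
  shows "witt_poly G \<tau> T P = op (witt_poly G \<tau> T (\<lambda>U. mvar (Inl U))) (witt_poly G \<tau> T (\<lambda>U. mvar (Inr U)))"
proof -
  let ?A = "\<lambda>S. S \<in> extensional (frame G \<tau>) \<and> (\<forall>T\<in>frame G \<tau>.
      op (witt_poly G \<tau> T (\<lambda>U. mvar (Inl U))) (witt_poly G \<tau> T (\<lambda>U. mvar (Inr U))) = witt_poly G \<tau> T S)"
  have "\<exists>!S. ?A S"
    using witt_solution_exists[OF frobenius_lift_mpoly[OF prime_p] op, of "\<lambda>U. mvar (Inl U)" "\<lambda>U. mvar (Inr U)"]
      witt_poly_inject by (metis (lifting))
  from theI'[OF this] show ?thesis using T unfolding def by simp
qed

lemma witt_sum_polys:
  assumes "T \<in> frame G \<tau>"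
  shows "witt_poly G \<tau> T (witt_sum_polys G \<tau>)
    = witt_poly G \<tau> T (\<lambda>U. mvar (Inl U)) + witt_poly G \<tau> T (\<lambda>U. mvar (Inr U))"
  by (rule witt_op_polys[OF _ _ assms, where op = "(+)"]) (simp_all add: witt_sum_polys_def)

lemma witt_prod_polys:
  assumes "T \<in> frame G \<tau>"
  shows "witt_poly G \<tau> T (witt_prod_polys G \<tau>)
    = witt_poly G \<tau> T (\<lambda>U. mvar (Inl U)) * witt_poly G \<tau> T (\<lambda>U. mvar (Inr U))"
  by (rule witt_op_polys[OF _ _ assms, where op = "(*)"]) (simp_all add: witt_prod_polys_def)

end

section \<open>Siblings and the square of the maximal ideal\<close>

context abelian_pro_p_group
begin

text \<open>
  Two classes that only their own coordinates can tell apart: all other variables occur in their Witt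
  polynomials in the same way.
\<close>

definition siblings :: "'a gclass \<Rightarrow> 'a gclass \<Rightarrow> bool" where
  "siblings S S' \<longleftrightarrow> S \<in> frame G \<tau> \<and> S' \<in> frame G \<tau> \<and> S \<noteq> S' \<and> csize S = csize S' \<and>
     lower S - {S} = lower S' - {S'}"

lemma siblings_proper_part: "siblings S S' \<Longrightarrow> proper_part S' x = proper_part S x"
  by (simp add: siblings_def proper_part_def)

lemma sibling_sum_polys:
  assumes "siblings S S'"
  defines "X \<equiv> \<lambda>U. mvar (Inl U)" and "Y \<equiv> \<lambda>U. mvar (Inr U)"
  shows "witt_sum_polys G \<tau> S - witt_sum_polys G \<tau> S' = (X S - X S') + (Y S - Y S')"
proof -
  let ?n = "of_nat (csize S) :: ('a gclass + 'a gclass) int_mpoly"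
  let ?A = "witt_sum_polys G \<tau>"
  have S: "S \<in> frame G \<tau>" "S' \<in> frame G \<tau>" "csize S' = csize S" using assms by (auto simp: siblings_def)
  have "?n * ?A S + proper_part S ?A = (?n * X S + proper_part S X) + (?n * Y S + proper_part S Y)"
    "?n * ?A S' + proper_part S ?A = (?n * X S' + proper_part S X) + (?n * Y S' + proper_part S Y)"
    using witt_sum_polys[OF S(1)] witt_sum_polys[OF S(2)]
    unfolding witt_poly_split[OF S(1)] witt_poly_split[OF S(2)] siblings_proper_part[OF assms(1)] S(3) X_def Y_def
    by blast+
  then have "?n * ?A S - ?n * ?A S' = (?n * X S + proper_part S X) + (?n * Y S + proper_part S Y)
      - ((?n * X S' + proper_part S X) + (?n * Y S' + proper_part S Y))"
    by (metis add_diff_cancel_right)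
  then have "?n * (?A S - ?A S') = ?n * ((X S - X S') + (Y S - Y S'))"
    by (simp add: algebra_simps)
  then show ?thesis by (rule of_nat_mult_cancel_mpoly) (rule csize_pos[OF S(1)])
qed

lemma sibling_prod_polys:
  assumes "siblings S S'"
  defines "X \<equiv> \<lambda>U. mvar (Inl U)" and "Y \<equiv> \<lambda>U. mvar (Inr U)"
  shows "witt_prod_polys G \<tau> S - witt_prod_polys G \<tau> S'
    = proper_part S X * (Y S - Y S') + proper_part S Y * (X S - X S')
      + of_nat (csize S) * (X S * Y S - X S' * Y S')"
proof -
  let ?n = "of_nat (csize S) :: ('a gclass + 'a gclass) int_mpoly"
  let ?M = "witt_prod_polys G \<tau>"
  have S: "S \<in> frame G \<tau>" "S' \<in> frame G \<tau>" "csize S' = csize S" using assms by (auto simp: siblings_def)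
  have "?n * ?M S + proper_part S ?M = (?n * X S + proper_part S X) * (?n * Y S + proper_part S Y)"
    "?n * ?M S' + proper_part S ?M = (?n * X S' + proper_part S X) * (?n * Y S' + proper_part S Y)"
    using witt_prod_polys[OF S(1)] witt_prod_polys[OF S(2)]
    unfolding witt_poly_split[OF S(1)] witt_poly_split[OF S(2)] siblings_proper_part[OF assms(1)] S(3) X_def Y_def
    by blast+
  then have "?n * ?M S - ?n * ?M S' = (?n * X S + proper_part S X) * (?n * Y S + proper_part S Y)
      - (?n * X S' + proper_part S X) * (?n * Y S' + proper_part S Y)"
    by (metis add_diff_cancel_right)
  then have "?n * (?M S - ?M S') = ?n * (proper_part S X * (Y S - Y S') + proper_part S Y * (X S - X S')
      + ?n * (X S * Y S - X S' * Y S'))"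
    by (simp add: algebra_simps)
  then show ?thesis by (rule of_nat_mult_cancel_mpoly) (rule csize_pos[OF S(1)])
qed

lemma mpoly_eval_proper_part:
  "mpoly_eval x (proper_part T P) = proper_part T (\<lambda>U. mpoly_eval x (P U))"
  by (simp add: proper_part_def mpoly_eval_hom)

abbreviation WG :: "('a gclass \<Rightarrow> 'k::comm_ring_1) ring" where
  "WG \<equiv> witt_burnside_ring G \<tau>"

lemma WG_add: "T \<in> frame G \<tau> \<Longrightarrow> (a \<oplus>\<^bsub>WG\<^esub> b) T = mpoly_eval (case_sum a b) (witt_sum_polys G \<tau> T)"
  and WG_mult: "T \<in> frame G \<tau> \<Longrightarrow> (a \<otimes>\<^bsub>WG\<^esub> b) T = mpoly_eval (case_sum a b) (witt_prod_polys G \<tau> T)"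
  by (simp_all add: witt_burnside_ring_def)

lemma sibling_difference_add:
  assumes "siblings S S'"
  shows "(a \<oplus>\<^bsub>WG\<^esub> b) S - (a \<oplus>\<^bsub>WG\<^esub> b) S' = (a S - a S') + (b S - b S')"
  using assms arg_cong[OF sibling_sum_polys[OF assms], of "mpoly_eval (case_sum a b)"]
  by (simp add: siblings_def WG_add mpoly_eval_hom)

lemma sibling_difference_mult:
  assumes "siblings S S'"
  shows "(a \<otimes>\<^bsub>WG\<^esub> b) S - (a \<otimes>\<^bsub>WG\<^esub> b) S' = proper_part S a * (b S - b S') + proper_part S b * (a S - a S')
      + of_nat (csize S) * (a S * b S - a S' * b S')"
  using assms arg_cong[OF sibling_prod_polys[OF assms], of "mpoly_eval (case_sum a b)"]
  by (simp add: siblings_def WG_mult mpoly_eval_hom mpoly_eval_proper_part)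

abbreviation triv :: "'a gclass" where "triv \<equiv> trivial_class G \<tau>"

lemma triv_in_lower: "T \<in> frame G \<tau> \<Longrightarrow> triv \<in> lower T"
  using subgroup.subset[OF subgroup_stab] by (simp add: lower_iff trivial_class_in_frame stab_trivial_class)

lemma lower_triv: "lower triv = {triv}"
proof -
  have "U \<in> lower triv \<longleftrightarrow> U = triv" for U
  proof
    assume "U \<in> lower triv"
    then have U: "U \<in> frame G \<tau>" "carrier G \<subseteq> stab U"
      using lower_iff[OF trivial_class_in_frame] stab_trivial_class by simp_all
    then have "stab U = stab triv"
      using subgroup.subset[OF subgroup_stab[OF U(1)]] stab_trivial_class by simp
    then show "U = triv" using stab_inject[OF U(1) trivial_class_in_frame] by simp
  qed (simp add: self_in_lower trivial_class_in_frame)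
  then show ?thesis by auto
qed

lemma p_dvd_csize:
  assumes U: "U \<in> frame G \<tau>" "U \<noteq> triv"
  shows "p dvd csize U"
proof -
  obtain n where n: "csize U = p ^ n" using quotient_p_group[OF U(1)] .
  have "csize triv < csize U" using csize_less[OF U(1)] triv_in_lower[OF U(1)] U(2) by blast
  then have "n \<noteq> 0" using csize_pos[OF trivial_class_in_frame] n by (intro notI) simp
  then show ?thesis using n by (simp add: dvd_power)
qed

text \<open>
  The coordinate at the point vanishes, and the coefficients of all other coordinates are multiples of \<open>p\<close>.
\<close>

lemma proper_part_eq_0:
  fixes a :: "'a gclass \<Rightarrow> 'k::comm_ring_1"
  assumes p0: "of_nat p = (0::'k)" and T: "T \<in> frame G \<tau>" and a: "a triv = 0"
  shows "proper_part T a = 0"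
  unfolding proper_part_def
proof (rule sum.neutral, rule ballI)
  fix U assume U: "U \<in> lower T - {T}"
  show "of_nat (csize U) * a U ^ (csize T div csize U) = 0"
  proof (cases "U = triv")
    case True
    have "csize T div csize U > 0"
      using csize_less[OF T U] csize_pos[OF trivial_class_in_frame] True by (simp add: div_greater_zero_iff)
    then show ?thesis using True a by (simp add: zero_power)
  next
    case False
    then have "p dvd csize U" using U p_dvd_csize by (simp add: lower_def)
    then show ?thesis using p0 by (auto elim!: dvdE)
  qed
qed

lemma triv_component_mult:
  "(a \<otimes>\<^bsub>WG\<^esub> b) triv = of_nat (csize triv) * a triv * b triv"
  and triv_component_add: "(a \<oplus>\<^bsub>WG\<^esub> b) triv = a triv + b triv"
proof -
  let ?n = "of_nat (csize triv) :: ('a gclass + 'a gclass) int_mpoly"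
  note T = trivial_class_in_frame
  have pp: "proper_part triv x = 0" for x :: "'a gclass \<Rightarrow> ('a gclass + 'a gclass) int_mpoly"
    by (simp add: proper_part_def lower_triv)
  have "?n * witt_prod_polys G \<tau> triv = ?n * (?n * mvar (Inl triv) * mvar (Inr triv))"
    using witt_prod_polys[OF T] unfolding witt_poly_split[OF T] pp by (simp add: mult_ac)
  then have "witt_prod_polys G \<tau> triv = ?n * mvar (Inl triv) * mvar (Inr triv)"
    by (rule of_nat_mult_cancel_mpoly) (rule csize_pos[OF T])
  then show "(a \<otimes>\<^bsub>WG\<^esub> b) triv = of_nat (csize triv) * a triv * b triv"
    by (simp add: WG_mult[OF T] mpoly_eval_hom)
  have "?n * witt_sum_polys G \<tau> triv = ?n * (mvar (Inl triv) + mvar (Inr triv))"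
    using witt_sum_polys[OF T] unfolding witt_poly_split[OF T] pp by (simp add: distrib_left)
  then have "witt_sum_polys G \<tau> triv = mvar (Inl triv) + mvar (Inr triv)"
    by (rule of_nat_mult_cancel_mpoly) (rule csize_pos[OF T])
  then show "(a \<oplus>\<^bsub>WG\<^esub> b) triv = a triv + b triv"
    by (simp add: WG_add[OF T] mpoly_eval_hom)
qed

text \<open>
  For two factors with vanishing coordinate at the point, each of the three terms of
  \<open>sibling_difference_mult\<close> is zero; and the difference of the coordinates at \<open>S\<close> and \<open>S'\<close> is additive.
\<close>

lemma square_max_ideal_siblings_eq:
  fixes c :: "'a gclass \<Rightarrow> 'k::field"
  assumes p0: "of_nat p = (0::'k)" and sib: "siblings S S'"
    and c: "c \<in> ideal_power WG (witt_max_ideal G \<tau>) 2"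
  shows "c S = c S'"
proof -
  let ?m = "witt_max_ideal G \<tau> :: ('a gclass \<Rightarrow> 'k) set"
  have S: "S \<in> frame G \<tau>" using sib by (simp add: siblings_def)
  have "S \<noteq> triv"
  proof
    assume "S = triv"
    then have "csize S' = csize triv" "S' \<noteq> triv" "S' \<in> frame G \<tau>" using sib by (auto simp: siblings_def)
    then show False using csize_less[of S' triv] triv_in_lower by auto
  qed
  then have n0: "of_nat (csize S) = (0::'k)"
    using p_dvd_csize[OF S] p0 by (auto elim!: dvdE)
  have triv0: "a triv = 0" if "a \<in> ideal_power WG ?m 1" for a
  proof -
    have "a \<in> carrier WG \<cdot>\<^bsub>WG\<^esub> ?m" using that by simp
    then show ?thesis
      by induction (auto simp: triv_component_mult triv_component_add witt_max_ideal_def)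
  qed
  have "c \<in> ideal_power WG ?m 1 \<cdot>\<^bsub>WG\<^esub> ?m" using c by (simp add: numeral_2_eq_2)
  then have "c S - c S' = 0"
  proof induction
    case (prod a b)
    have "a triv = 0" "b triv = 0" using prod triv0 by (auto simp: witt_max_ideal_def)
    then show ?case
      using proper_part_eq_0[OF p0 S] n0 by (simp add: sibling_difference_mult[OF sib])
  next
    case (sum a b)
    then show ?case by (simp add: sibling_difference_add[OF sib])
  qed
  then show ?thesis by simp
qed

text \<open>
  The square \<open>V\<close> of the maximal ideal is open in the adic topology. If it were open in the other one, it
  would contain \<open>a + I\<^sub>n\<close> for some \<open>a \<in> V\<close>, and adding to \<open>a\<close> a vector of \<open>I\<^sub>n\<close> that is nonzero at
  one of two siblings only would not lead out of \<open>V\<close>.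
\<close>

theorem topologies_differ:
  assumes char: "CHAR('k::field) = p"
    and sib: "\<And>n. \<exists>S S'. siblings S S' \<and> n \<le> csize S"
  shows "(initial_vanishing_topology G \<tau> :: ('a gclass \<Rightarrow> 'k) topology)
    \<noteq> adic_topology WG (witt_max_ideal G \<tau>)"
proof
  let ?m = "witt_max_ideal G \<tau> :: ('a gclass \<Rightarrow> 'k) set"
  let ?V = "ideal_power WG ?m 2"
  have p0: "of_nat p = (0::'k)" using char of_nat_CHAR by metis
  have V: "?V = (carrier WG \<cdot>\<^bsub>WG\<^esub> ?m) \<cdot>\<^bsub>WG\<^esub> ?m" by (simp add: numeral_2_eq_2)
  have "openin (adic_topology WG ?m) ?V"
    unfolding adic_topology_def openin_linear_topology[OF antimono_power_witt_max_ideal]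
  proof (intro conjI ballI)
    show "?V \<subseteq> carrier WG"
      using antimonoD[OF antimono_power_witt_max_ideal[of G \<tau>], of 0 2] by simp
    fix a assume "a \<in> ?V"
    then have "a <+\<^bsub>WG\<^esub> ?V \<subseteq> ?V" by (auto simp: V a_l_coset_def' intro: ideal_prod.sum)
    then show "\<exists>n\<ge>1. a <+\<^bsub>WG\<^esub> ideal_power WG ?m n \<subseteq> ?V" by (intro exI[of _ 2]) simp
  qed
  moreover assume "initial_vanishing_topology G \<tau> = adic_topology WG ?m"
  ultimately have open_V: "\<forall>a\<in>?V. \<exists>n\<ge>1. a <+\<^bsub>WG\<^esub> vanishing_ideal G \<tau> n \<subseteq> ?V"
    unfolding initial_vanishing_topology_def
    by (metis openin_linear_topology[OF antimono_vanishing_ideal])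
  define z :: "'a gclass \<Rightarrow> 'k" where "z = (\<lambda>T\<in>frame G \<tau>. 0)"
  have z: "z \<in> carrier WG" "z \<in> ?m"
    by (auto simp: z_def witt_max_ideal_def witt_burnside_ring_def trivial_class_in_frame)
  then have a: "(z \<otimes>\<^bsub>WG\<^esub> z) \<otimes>\<^bsub>WG\<^esub> z \<in> ?V" (is "?a \<in> _")
    unfolding V by (intro ideal_prod.prod)
  then obtain n where n: "?a <+\<^bsub>WG\<^esub> vanishing_ideal G \<tau> n \<subseteq> ?V" using open_V by blast
  obtain S S' where S: "siblings S S'" "n \<le> csize S" using sib by blast
  define e :: "'a gclass \<Rightarrow> 'k" where "e = (\<lambda>T\<in>frame G \<tau>. if T = S then 1 else 0)"
  have "e \<in> vanishing_ideal G \<tau> n"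
    using S(2) by (auto simp: e_def vanishing_ideal_def witt_burnside_ring_def)
  then have "?a \<oplus>\<^bsub>WG\<^esub> e \<in> ?V" using n by (auto simp: a_l_coset_def')
  then have "(?a \<oplus>\<^bsub>WG\<^esub> e) S = (?a \<oplus>\<^bsub>WG\<^esub> e) S'"
    by (rule square_max_ideal_siblings_eq[OF p0 S(1)])
  moreover have "?a S = ?a S'" by (rule square_max_ideal_siblings_eq[OF p0 S(1) a])
  moreover note sibling_difference_add[OF S(1), of ?a e]
  ultimately have "e S = e S'" by (simp only: diff_self add_0_left right_minus_eq eq_commute[of 0])
  moreover have "S \<in> frame G \<tau>" "S' \<in> frame G \<tau>" "S \<noteq> S'" using S(1) by (simp_all add: siblings_def)
  ultimately show False by (simp add: e_def)
qed

text \<open>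
  In the cyclic group of order \<open>p\<^sup>n\<close> every nontrivial subgroup contains the one of order \<open>p\<close>. So the
  subgroups properly containing the kernel of \<open>\<eta>\<close> are those that contain all \<open>x\<close> with \<open>p\<^sup>n\<^sup>-\<^sup>1\<close> dividing
  \<open>\<eta> x\<close>.
\<close>

lemma class_of_character:
  assumes n: "n \<ge> 1" and hom: "\<eta> \<in> hom G (integer_mod_group (p ^ n))"
    and surj: "\<eta> ` carrier G = carrier (integer_mod_group (p ^ n))"
    and op: "\<And>c. openin \<tau> {x \<in> carrier G. \<eta> x = c}"
  obtains S where "S \<in> frame G \<tau>" "stab S = {x \<in> carrier G. \<eta> x = 0}" "csize S = p ^ n"
    "lower S - {S} = {U \<in> frame G \<tau>. {x \<in> carrier G. int (p ^ (n - 1)) dvd \<eta> x} \<subseteq> stab U}"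
proof -
  interpret h: group_hom G "integer_mod_group (p ^ n)" \<eta>
    by (intro group_hom.intro group_hom_axioms.intro is_group hom) simp
  let ?K = "kernel G (integer_mod_group (p ^ n)) \<eta>"
  have ker: "?K = {x \<in> carrier G. \<eta> x = 0}" by (simp add: kernel_def)
  have car: "carrier (integer_mod_group (p ^ n)) = {0..<int (p ^ n)}"
    using p_gt_1 by (simp add: carrier_integer_mod_group)
  have K: "subgroup ?K G" by (rule h.subgroup_kernel)
  have "card (rcosets ?K) = card (carrier (integer_mod_group (p ^ n)))"
    using h.FactGroup_iso_set[OF surj] by (auto simp: iso_def FactGroup_def dest: bij_betw_same_card)
  then have card: "card (rcosets ?K) = p ^ n" by (simp add: car del: of_nat_power)
  then have fin: "finite (rcosets ?K)" using p_gt_1 by (intro card_ge_0_finite) simp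
  have open_coset: "openin \<tau> C" if C: "C \<in> rcosets ?K" for C
  proof -
    obtain g where g: "g \<in> carrier G" "C = ?K #> g" using C by (auto simp: RCOSETS_def)
    have "C = {x \<in> carrier G. \<eta> x = \<eta> g}"
    proof (intro equalityI subsetI)
      fix x assume "x \<in> C"
      then obtain k where "k \<in> carrier G" "\<eta> k = 0" "x = k \<otimes> g" using g ker by (auto simp: r_coset_def)
      moreover have "\<eta> g mod int (p ^ n) = \<eta> g" using h.hom_closed[OF g(1)] by (simp add: car)
      ultimately show "x \<in> {x \<in> carrier G. \<eta> x = \<eta> g}" using g h.hom_mult[of k g] by simp
    next
      fix x assume x: "x \<in> {x \<in> carrier G. \<eta> x = \<eta> g}"
      have "\<eta> (x \<otimes> inv g) = \<one>\<^bsub>integer_mod_group (p ^ n)\<^esub>"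
        using x g h.hom_mult[of x "inv g"] h.hom_inv[OF g(1)] h.H.r_inv[OF h.hom_closed[OF g(1)]] by simp
      then have "x \<otimes> inv g \<in> ?K" using x g by (simp add: kernel_def)
      moreover have "x = (x \<otimes> inv g) \<otimes> g" using x g by (simp add: m_assoc)
      ultimately show "x \<in> C" unfolding g(2) r_coset_def by blast
    qed
    then show ?thesis using op by simp
  qed
  define S where "S = gset_iso_rel G \<tau> `` {coset_gset ?K}"
  note fdt = fdt_coset_gset[OF K fin open_coset]
  have S: "S \<in> frame G \<tau>" unfolding S_def by (rule class_of_gset(1)[OF fdt])
  have stab: "stab S = ?K" unfolding S_def using class_of_gset(2)[OF fdt] coset_gset(2)[OF K] by (rule trans)
  let ?R = "{x \<in> carrier G. int (p ^ (n - 1)) dvd \<eta> x}"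
  have "U \<in> lower S - {S} \<longleftrightarrow> ?R \<subseteq> stab U" if U: "U \<in> frame G \<tau>" for U
  proof
    assume L: "U \<in> lower S - {S}"
    then have KU: "?K \<subseteq> stab U" "stab U \<noteq> ?K" using lower_iff[OF S] stab_inject[OF U S] stab by auto
    note sU = subgroup_stab[OF U]
    obtain x where x: "x \<in> stab U" "x \<notin> ?K" using KU by blast
    have xG: "x \<in> carrier G" using subgroup.mem_carrier[OF sU x(1)] .
    have chi: "0 < \<eta> x" "\<eta> x < int (p ^ n)"
      using h.hom_closed[OF xG] x xG ker by (auto simp: car order_less_le)
    have "gcd (\<eta> x) (int (p ^ n)) dvd int (p ^ (n - 1))"
    proof -
      have "nat (gcd (\<eta> x) (int (p ^ n))) dvd p ^ n"
        by (metis gcd_dvd2 int_nat_eq gcd_ge_0_int int_dvd_int_iff)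
      then obtain j where j: "j \<le> n" "nat (gcd (\<eta> x) (int (p ^ n))) = p ^ j"
        using divides_primepow_nat[OF prime_p] by blast
      then have gj: "gcd (\<eta> x) (int (p ^ n)) = int (p ^ j)" by (metis gcd_ge_0_int int_nat_eq)
      have "int (p ^ j) \<le> \<eta> x" using gj chi(1) by (metis gcd_le1_int)
      then have "j \<noteq> n" using chi(2) by auto
      then have "p ^ j dvd p ^ (n - 1)" using j(1) by (intro le_imp_power_dvd) linarith
      then show ?thesis unfolding gj by (simp only: int_dvd_int_iff)
    qed
    \<comment> \<open>Hence some multiple of \<open>\<eta> x\<close> is \<open>p\<^sup>n\<^sup>-\<^sup>1\<close> modulo \<open>p\<^sup>n\<close>, so \<open>x\<close> and the kernel generate a group containing \<open>?R\<close>.\<close>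
    then obtain c where c: "int (p ^ (n - 1)) = gcd (\<eta> x) (int (p ^ n)) * c" by (elim dvdE)
    obtain u v where "u * \<eta> x + v * int (p ^ n) = gcd (\<eta> x) (int (p ^ n))" using bezout_int by blast
    then have uv: "int (p ^ (n - 1)) = c * u * \<eta> x + c * v * int (p ^ n)"
      unfolding c by (metis distrib_left mult.assoc mult.commute)
    show "?R \<subseteq> stab U"
    proof
      fix r assume "r \<in> ?R"
      then obtain b where r: "r \<in> carrier G" "\<eta> r = int (p ^ (n - 1)) * b" by (auto elim: dvdE)
      let ?y = "x [^] (b * (c * u) :: int)"
      have yG: "?y \<in> carrier G" using xG by simp
      have "\<eta> ?y = (b * (c * u) * \<eta> x) mod int (p ^ n)"
        using h.hom_int_pow[OF xG] h.hom_closed[OF xG] by (simp add: int_pow_integer_mod_group)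
      also have "\<dots> = (b * (c * u) * \<eta> x + b * (c * v) * int (p ^ n)) mod int (p ^ n)" by simp
      also have "b * (c * u) * \<eta> x + b * (c * v) * int (p ^ n) = \<eta> r"
        unfolding r uv by (simp add: algebra_simps)
      also have "\<eta> r mod int (p ^ n) = \<eta> r" using h.hom_closed[OF r(1)] by (simp add: car)
      finally have "\<eta> ?y = \<eta> r" .
      then have "\<eta> (r \<otimes> inv ?y) = \<one>\<^bsub>integer_mod_group (p ^ n)\<^esub>"
        using r yG h.hom_mult[of r "inv ?y"] h.hom_inv[OF yG] h.H.r_inv[OF h.hom_closed[OF yG]] by simp
      then have "r \<otimes> inv ?y \<in> stab U" using KU(1) r yG by (auto simp: kernel_def)
      moreover have "?y \<in> stab U" using subgroup_int_pow_closed[OF sU x(1)] .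
      moreover have "r = (r \<otimes> inv ?y) \<otimes> ?y" using r yG by (simp add: m_assoc)
      ultimately show "r \<in> stab U" using subgroup.m_closed[OF sU] by metis
    qed
  next
    assume R: "?R \<subseteq> stab U"
    have "?K \<subseteq> stab U" using R ker by auto
    then have "U \<in> lower S" using U stab lower_iff[OF S] by simp
    moreover have "U \<noteq> S"
    proof
      assume "U = S"
      have "int (p ^ (n - 1)) \<in> \<eta> ` carrier G"
        unfolding surj car using n p_gt_1 by (simp add: power_strict_increasing del: of_nat_power)
      then obtain r where "r \<in> carrier G" "\<eta> r = int (p ^ (n - 1))" by (auto simp del: of_nat_power)
      moreover from this have "r \<in> stab U" using R by auto
      ultimately show False using \<open>U = S\<close> stab ker p_gt_1 by auto
    qed
    ultimately show "U \<in> lower S - {S}" by simp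
  qed
  then have "lower S - {S} = {U \<in> frame G \<tau>. ?R \<subseteq> stab U}" using lower_iff[OF S] by blast
  then show ?thesis using that[OF S] stab ker csize_eq[OF S] card by simp
qed

lemma siblings_of_characters:
  assumes n: "n \<ge> 1"
    and \<eta>: "\<eta> \<in> hom G (integer_mod_group (p ^ n))" "\<eta> ` carrier G = carrier (integer_mod_group (p ^ n))"
      "\<And>c. openin \<tau> {x \<in> carrier G. \<eta> x = c}"
    and \<eta>': "\<eta>' \<in> hom G (integer_mod_group (p ^ n))" "\<eta>' ` carrier G = carrier (integer_mod_group (p ^ n))"
      "\<And>c. openin \<tau> {x \<in> carrier G. \<eta>' x = c}"
    and same: "\<And>x. x \<in> carrier G \<Longrightarrow> int (p ^ (n - 1)) dvd \<eta> x \<longleftrightarrow> int (p ^ (n - 1)) dvd \<eta>' x"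
    and differ: "x \<in> carrier G" "\<eta> x = 0" "\<eta>' x \<noteq> 0"
  shows "\<exists>S S'. siblings S S' \<and> csize S = p ^ n"
proof -
  obtain S where S: "S \<in> frame G \<tau>" "stab S = {x \<in> carrier G. \<eta> x = 0}" "csize S = p ^ n"
    "lower S - {S} = {U \<in> frame G \<tau>. {x \<in> carrier G. int (p ^ (n - 1)) dvd \<eta> x} \<subseteq> stab U}"
    using class_of_character[OF n \<eta>] .
  obtain S' where S': "S' \<in> frame G \<tau>" "stab S' = {x \<in> carrier G. \<eta>' x = 0}" "csize S' = p ^ n"
    "lower S' - {S'} = {U \<in> frame G \<tau>. {x \<in> carrier G. int (p ^ (n - 1)) dvd \<eta>' x} \<subseteq> stab U}"
    using class_of_character[OF n \<eta>'] .
  have "stab S \<noteq> stab S'" using S(2) S'(2) differ by auto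
  then have "S \<noteq> S'" by blast
  moreover have "{x \<in> carrier G. int (p ^ (n - 1)) dvd \<eta> x} = {x \<in> carrier G. int (p ^ (n - 1)) dvd \<eta>' x}"
    using same by auto
  ultimately have "siblings S S'" using S S' by (simp add: siblings_def)
  then show ?thesis using S(3) by blast
qed

end

section \<open>The group \<open>\<int>\<^sub>p\<^sup>d\<close> and its characters\<close>

lemma mem_carrier_Zp:
  assumes "p > 0"
  shows "x \<in> carrier (Zp_group p) \<longleftrightarrow>
    (\<forall>n. 0 \<le> x n \<and> x n < int (p ^ n)) \<and> (\<forall>n. x (Suc n) mod int (p ^ n) = x n)"
  using assms by (auto simp: Zp_group_def carrier_integer_mod_group PiE_iff)

lemma mult_Zp_power:
  "x \<otimes>\<^bsub>Zp_power_group p d\<^esub> y = (\<lambda>i\<in>{..<d}. \<lambda>n. (x i n + y i n) mod int (p ^ n))"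
  by (simp add: Zp_power_group_def Zp_group_def product_group_def fun_eq_iff restrict_def)

lemma carrier_Zp_power: "carrier (Zp_power_group p d) = {..<d} \<rightarrow>\<^sub>E carrier (Zp_group p)"
  by (simp add: Zp_power_group_def)

lemma one_Zp_power: "\<one>\<^bsub>Zp_power_group p d\<^esub> = (\<lambda>i\<in>{..<d}. \<lambda>n. 0)"
  by (simp add: Zp_power_group_def Zp_group_def product_group_def restrict_def fun_eq_iff)

lemma coordinate_range:
  assumes "p > 0" "x \<in> carrier (Zp_power_group p d)" "i < d"
  shows "0 \<le> x i n" "x i n < int (p ^ n)"
proof -
  have "x i \<in> carrier (Zp_group p)" using assms by (auto simp: carrier_Zp_power)
  then show "0 \<le> x i n" "x i n < int (p ^ n)" using mem_carrier_Zp[OF assms(1)] by auto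
qed

lemma coordinate_hom:
  assumes "p > 0" "i < d"
  shows "(\<lambda>x. x i n) \<in> hom (Zp_power_group p d) (integer_mod_group (p ^ n))"
  using assms coordinate_range[OF assms(1) _ assms(2)]
  by (intro homI) (auto simp: mult_Zp_power carrier_integer_mod_group)

lemma openin_coordinate:
  assumes "i < d"
  shows "openin (Zp_power_topology p d) {x \<in> carrier (Zp_power_group p d). x i n = c}"
proof -
  let ?D = "\<lambda>n. discrete_topology (carrier (integer_mod_group (p ^ n)))"
  have "continuous_map (Zp_power_topology p d) (Zp_topology p) (\<lambda>x. x i)"
    unfolding Zp_power_topology_def using assms by (intro continuous_map_product_projection) auto
  moreover have "continuous_map (Zp_topology p) (?D n) (\<lambda>x. x n)"
    unfolding Zp_topology_def
    by (intro continuous_map_from_subtopology continuous_map_product_projection) auto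
  ultimately have "continuous_map (Zp_power_topology p d) (?D n) ((\<lambda>x. x n) \<circ> (\<lambda>x. x i))"
    by (rule continuous_map_compose)
  then have cont: "continuous_map (Zp_power_topology p d) (?D n) (\<lambda>x. x i n)" by (simp add: comp_def)
  show ?thesis
  proof (cases "c \<in> carrier (integer_mod_group (p ^ n))")
    case True
    then show ?thesis
      using openin_continuous_map_preimage[OF cont, of "{c}"] by (simp add: topspace_Zp_power)
  next
    case False
    then have "{x \<in> carrier (Zp_power_group p d). x i n = c} = {}"
      using continuous_map_image_subset_topspace[OF cont] by (auto simp: topspace_Zp_power)
    then show ?thesis by (simp only: openin_empty)
  qed
qed

lemma openin_two_coordinates:
  assumes "i < d" "j < d"
  shows "openin (Zp_power_topology p d) {x \<in> carrier (Zp_power_group p d). f (x i n) (x j n) = c}"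
proof -
  let ?A = "\<lambda>i u. {x \<in> carrier (Zp_power_group p d). x i n = u}"
  have "{x \<in> carrier (Zp_power_group p d). f (x i n) (x j n) = c}
      = (\<Union>(u, v)\<in>{(u, v). f u v = c}. ?A i u \<inter> ?A j v)" by auto
  also have "openin (Zp_power_topology p d) \<dots>"
    using openin_coordinate assms by (intro openin_Union ballI) (auto intro!: openin_Int)
  finally show ?thesis .
qed

text \<open>
  In each coordinate \<open>\<int>/p\<^sup>n\<close> the multiples \<open>p\<^sup>N g\<close> vanish for \<open>N \<ge> n\<close>. An open subgroup therefore
  contains some \<open>p\<^sup>N g\<close>, so that the finite discrete quotients are \<open>p\<close>-groups.
\<close>

lemma limitin_p_powers:
  assumes p: "p > 0" and g: "g \<in> carrier (Zp_power_group p d)"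
  shows "limitin (Zp_power_topology p d) (\<lambda>N. g [^]\<^bsub>Zp_power_group p d\<^esub> (p ^ N))
    \<one>\<^bsub>Zp_power_group p d\<^esub> sequentially"
proof -
  interpret G: group "Zp_power_group p d" by (rule group_Zp_power[OF p])
  let ?g = "\<lambda>N::nat. g [^]\<^bsub>Zp_power_group p d\<^esub> (p ^ N)"
  have gc: "?g N \<in> carrier (Zp_power_group p d)" for N using g by simp
  have coord: "?g N i n = (int (p ^ N) * g i n) mod int (p ^ n)" if i: "i < d" for N i n
    using hom_nat_pow[OF coordinate_hom[OF p i, of n] g G.is_group, of "p ^ N"] by simp
  have ev: "eventually (\<lambda>N. ?g N i n = 0) sequentially" if i: "i < d" for i n
    unfolding eventually_sequentially
  proof (intro exI allI impI)
    fix N assume "n \<le> N"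
    then have "int (p ^ n) dvd int (p ^ N) * g i n"
      by (intro dvd_mult2) (simp add: le_imp_power_dvd)
    then show "?g N i n = 0" by (simp add: coord[OF i])
  qed
  have z: "(\<lambda>n. 0) \<in> carrier (Zp_group p)" using p by (simp add: mem_carrier_Zp)
  have "limitin (Zp_topology p) (\<lambda>N. ?g N i) (\<lambda>n. 0) sequentially" if i: "i < d" for i
    unfolding Zp_topology_def limitin_subtopology
  proof (intro conjI z)
    have gi: "?g N i \<in> carrier (Zp_group p)" for N using gc[of N] i by (auto simp: carrier_Zp_power)
    then show "eventually (\<lambda>N. ?g N i \<in> carrier (Zp_group p)) sequentially" by simp
    have sub: "carrier (Zp_group p) \<subseteq> (\<Pi>\<^sub>E n\<in>UNIV. carrier (integer_mod_group (p ^ n)))"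
      by (auto simp: Zp_group_def)
    show "limitin (product_topology (\<lambda>n. discrete_topology (carrier (integer_mod_group (p ^ n)))) UNIV)
        (\<lambda>N. ?g N i) (\<lambda>n. 0) sequentially"
      unfolding limitin_componentwise
    proof (intro conjI ballI)
      show "eventually (\<lambda>N. ?g N i \<in> topspace (product_topology
          (\<lambda>n. discrete_topology (carrier (integer_mod_group (p ^ n)))) UNIV)) sequentially"
        using gi sub by (intro always_eventually allI) auto
      fix n
      show "limitin (discrete_topology (carrier (integer_mod_group (p ^ n)))) (\<lambda>N. ?g N i n) 0 sequentially"
        using ev[OF i] by (intro limitin_eventually) simp_all
    qed simp
  qed
  then show ?thesis
    unfolding Zp_power_topology_def limitin_componentwise one_Zp_power
    using gc topspace_Zp_power[of p d] by (simp add: Zp_power_topology_def)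
qed

lemma abelian_pro_p_Zp_power:
  assumes p: "Factorial_Ring.prime p"
  shows "abelian_pro_p_group (Zp_power_group p d) (Zp_power_topology p d) p"
proof -
  have p0: "p > 0" using p prime_gt_0_nat by blast
  interpret G: group "Zp_power_group p d" by (rule group_Zp_power[OF p0])
  interpret G: comm_group "Zp_power_group p d"
    by (rule G.group_comm_groupI) (simp add: mult_Zp_power add.commute)
  interpret G: top_abelian_group "Zp_power_group p d" "Zp_power_topology p d"
    by unfold_locales (rule topspace_Zp_power)
  show ?thesis
  proof
    fix T and g assume T: "T \<in> frame (Zp_power_group p d) (Zp_power_topology p d)"
      and g: "g \<in> carrier (Zp_power_group p d)"
    have sub: "subgroup (G.stab T) (Zp_power_group p d)" by (rule G.subgroup_stab[OF T])
    have "openin (Zp_power_topology p d) (G.stab T)"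
      by (rule G.openin_kernel_invariant[OF G.frame_rep(1)[OF T]])
        (use sub in \<open>auto simp: subgroup.subset G.stab_def[symmetric] subgroup.m_closed dest: subgroup.mem_carrier\<close>)
    moreover have "\<one>\<^bsub>Zp_power_group p d\<^esub> \<in> G.stab T" by (rule subgroup.one_closed[OF sub])
    ultimately have "eventually (\<lambda>N. g [^]\<^bsub>Zp_power_group p d\<^esub> (p ^ N) \<in> G.stab T) sequentially"
      using limitin_p_powers[OF p0 g] unfolding limitin_def by blast
    then show "\<exists>N::nat. g [^]\<^bsub>Zp_power_group p d\<^esub> (p ^ N) \<in> G.stab T"
      by (auto simp: eventually_sequentially)
  qed (rule p)
qed

text \<open>
  The characters \<open>x\<^sub>0\<close> and \<open>x\<^sub>0 + p\<^sup>n\<^sup>-\<^sup>1 x\<^sub>1\<close> modulo \<open>p\<^sup>n\<close> are divisible by \<open>p\<^sup>n\<^sup>-\<^sup>1\<close> at the same elements, but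
  the second one does not vanish at the unit vector of the coordinate \<open>1\<close>.
\<close>

lemma Zp_power_siblings:
  assumes p: "Factorial_Ring.prime p" and d: "d \<ge> 2" and n: "n \<ge> 1"
  shows "\<exists>S S'. abelian_pro_p_group.siblings (Zp_power_group p d) (Zp_power_topology p d) S S' \<and> csize S = p ^ n"
proof -
  interpret abelian_pro_p_group "Zp_power_group p d" "Zp_power_topology p d" p
    by (rule abelian_pro_p_Zp_power[OF p])
  let ?G = "Zp_power_group p d"
  have p0: "p > 0" using p_gt_1 by simp
  have d': "0 < d" "1 < d" using d by auto
  have car: "carrier (integer_mod_group (p ^ n)) = {0..<int (p ^ n)}"
    using p_gt_1 by (simp add: carrier_integer_mod_group)
  define el :: "nat \<Rightarrow> int \<Rightarrow> nat \<Rightarrow> nat \<Rightarrow> int" where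
    "el j c = (\<lambda>i\<in>{..<d}. \<lambda>m. if i = j then c mod int (p ^ m) else 0)" for j c
  have el: "el j c \<in> carrier ?G" for j c
    using p0 by (auto simp: el_def carrier_Zp_power mem_carrier_Zp mod_mod_cancel)
  let ?\<eta> = "\<lambda>x::nat \<Rightarrow> nat \<Rightarrow> int. x 0 n"
  let ?\<eta>' = "\<lambda>x::nat \<Rightarrow> nat \<Rightarrow> int. (x 0 n + int (p ^ (n - 1)) * x 1 n) mod int (p ^ n)"
  have surj: "c \<in> f ` carrier ?G" if "c \<in> {0..<int (p ^ n)}" "f (el 0 c) = c mod int (p ^ n)" for f c
    using that el[of 0 c] by (intro image_eqI[of _ _ "el 0 c"]) auto
  show ?thesis
  proof (rule siblings_of_characters[OF n, of ?\<eta> ?\<eta>'])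
    show "?\<eta> \<in> hom ?G (integer_mod_group (p ^ n))" by (rule coordinate_hom[OF p0 d'(1)])
    show "?\<eta> ` carrier ?G = carrier (integer_mod_group (p ^ n))"
      unfolding car using coordinate_range[OF p0 _ d'(1)] surj[of _ ?\<eta>] d' by (auto simp: el_def simp del: of_nat_power)
    show "openin (Zp_power_topology p d) {x \<in> carrier ?G. ?\<eta> x = c}" for c
      by (rule openin_coordinate[OF d'(1)])
    show "?\<eta>' \<in> hom ?G (integer_mod_group (p ^ n))"
    proof (rule homI)
      show "?\<eta>' x \<in> carrier (integer_mod_group (p ^ n))" for x unfolding car using p0 by simp
      fix x y
      show "?\<eta>' (x \<otimes>\<^bsub>?G\<^esub> y) = ?\<eta>' x \<otimes>\<^bsub>integer_mod_group (p ^ n)\<^esub> ?\<eta>' y"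
      proof -
        have "((a + b) mod m + q * ((c + e) mod m)) mod m = ((a + q * c) mod m + (b + q * e) mod m) mod m"
          for a b c e q m :: int
        proof -
          have "((a + b) mod m + q * ((c + e) mod m)) mod m = (a + b + q * (c + e)) mod m"
            by (intro mod_add_cong mod_mult_right_eq mod_mod_trivial)
          also have "a + b + q * (c + e) = (a + q * c) + (b + q * e)" by (simp add: algebra_simps)
          finally show ?thesis by (simp only: mod_simps)
        qed
        then show ?thesis using d' by (simp add: mult_Zp_power del: of_nat_power)
      qed
    qed
    show "?\<eta>' ` carrier ?G = carrier (integer_mod_group (p ^ n))"
      unfolding car using surj[of _ ?\<eta>'] d' p0 by (auto simp: el_def simp del: of_nat_power)
    show "openin (Zp_power_topology p d) {x \<in> carrier ?G. ?\<eta>' x = c}" for c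
      by (rule openin_two_coordinates[OF d'])
    have "int (p ^ (n - 1)) dvd int (p ^ n)" by (simp add: le_imp_power_dvd)
    then show "int (p ^ (n - 1)) dvd ?\<eta> x \<longleftrightarrow> int (p ^ (n - 1)) dvd ?\<eta>' x" for x
      by (simp add: dvd_mod_iff dvd_add_left_iff del: of_nat_power)
    show "el 1 1 \<in> carrier ?G" by (rule el)
    show "?\<eta> (el 1 1) = 0" using d' by (simp add: el_def)
    have "p ^ (n - 1) < p ^ n" "p ^ 0 < p ^ n"
      using n p_gt_1 by (intro power_strict_increasing; simp)+
    then have "int (p ^ (n - 1)) < int (p ^ n)" "1 < int (p ^ n)" by (simp_all del: of_nat_power)
    then show "?\<eta>' (el 1 1) \<noteq> 0" using d' p0 by (simp add: el_def del: of_nat_power)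
  qed
qed

theorem corollary3p24:
  fixes p d :: nat
  assumes "Factorial_Ring.prime p" and "CHAR('k::field) = p" and "d \<ge> 2"
  shows "(initial_vanishing_topology (Zp_power_group p d) (Zp_power_topology p d)
            :: ((nat \<Rightarrow> nat \<Rightarrow> int) gclass \<Rightarrow> 'k) topology)
         \<noteq> adic_topology (witt_burnside_ring (Zp_power_group p d) (Zp_power_topology p d))
             (witt_max_ideal (Zp_power_group p d) (Zp_power_topology p d))"
proof -
  interpret abelian_pro_p_group "Zp_power_group p d" "Zp_power_topology p d" p
    by (rule abelian_pro_p_Zp_power[OF assms(1)])
  have "\<exists>S S'. siblings S S' \<and> n \<le> csize S" for n
  proof -
    obtain S S' where S: "siblings S S'" "csize S = p ^ Suc n"
      using Zp_power_siblings[OF assms(1,3), of "Suc n"] by auto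
    have "n < p ^ n" using power_gt_expt[of p n] p_gt_1 by simp
    also have "\<dots> \<le> csize S" unfolding S(2) using p_gt_1 by simp
    finally show ?thesis using S(1) by auto
  qed
  then show ?thesis by (rule topologies_differ[OF assms(2)])
qed

end
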